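(* The linear subspace $$\mathfrak{e}_7 := \mathfrak{so}(8)\oplus\mathfrak{sp}(1)^3\oplus(\mathbb{O}\otimes\mathbb{H})^3$$ of $\mathfrak{e}_8=(\mathfrak{so}(8)\oplus\mathfrak{so}(8))\times(\mathbb{O}\otimes\mathbb{O})^3$ is a Lie subalgebra of $\mathfrak{e}_8$, which is isomorphic to the Lie algebra of the exceptional compact Lie group $\mathrm{E}_7$.
   Context: Octonions: $\mathbb{O}$ is the 8-dimensional real octonion algebra with basis $e=e_0$ (the identity), $e_1,\dots,e_7$, where $e_i^2=-e$ for $i\ge1$ and $e_1e_2=e_3$, $e_1e_4=e_5$, $e_2e_4=e_6$, $e_3e_4=e_7$, $e_5e_3=e_6$, $e_6e_1=e_7$, $e_7e_2=e_5$ (the remaining products are determined by the alternative laws). Via this basis $\mathbb{O}=\mathbb{R}^8$ (column vectors), with standard scalar product $\langle\cdot,\cdot\rangle$. Conjugation $a\mapsto\bar a$ is linear with $\bar e_0=e_0$, $\bar e_i=-e_i$ for $i\ge1$. $\mathrm{Pu}(\mathbb{O})$ is the span of $e_1,\dots,e_7$. $L_a(x)=ax$. Wedge and triality: $\mathfrak{so}(8)$ is the Lie algebra of real skew-symmetric $8\times8$ matrices with commutator bracket; for $x,y\in\mathbb{O}=\mathbb{R}^8$, $x\wedge y:=xy^t-yx^t\in\mathfrak{so}(8)$ (matrix products). $\lambda$ is the order-three automorphism of $\mathfrak{so}(8)$ determined by $\lambda(a\wedge b)=\tfrac12 L_{\bar b}\circ L_{\bar a}$ for $a\in\mathrm{Pu}(\mathbb{O})$,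 $b\in\mathbb{O}$, $\langle a,b\rangle=0$; $\lambda^2=\lambda\circ\lambda$. $\Lambda$ is the automorphism of $\mathfrak{so}(8)\oplus\mathfrak{so}(8)$ given by $\Lambda(P,Q)=(\lambda(P),\lambda(Q))$, and $\Lambda^2=\Lambda\circ\Lambda$. Oct-octonions: $\mathbb{O}\otimes\mathbb{O}$ (tensor product over $\mathbb{R}$) has multiplication $(a\otimes b)\ast(c\otimes d)=ac\otimes bd$ and linear conjugation $\overline{a\otimes b}=\bar a\otimes\bar b$. It is identified with the space $\mathbb{R}(8)$ of real $8\times8$ matrices via $x\otimes y=xy^t$. For $A=(P,Q)\in\mathfrak{so}(8)\oplus\mathfrak{so}(8)$ and $X,Y\in\mathbb{R}(8)$: $A.X:=PX-XQ$ and $X\curlywedge Y:=(XY^t-YX^t,\;X^tY-Y^tX)$ (ordinary matrix products). The Lie algebra $\mathfrak{e}_8$ (compact real form) is the vector space $(\mathfrak{so}(8)\oplus\mathfrak{so}(8))\times(\mathbb{O}\otimes\mathbb{O})^3$ with Lie bracket $[(A,u,v,w),(B,x,y,z)]=(C,r,s,t)$, where \begin{align*} C &=[A,B]-4\,u \curlywedge x - 4\Lambda^2(v \curlywedge y) - 4\Lambda(w \curlywedge z),\\ r &= A.x-B.u+\overline{v \ast z}-\overline{y \ast w},\\ s &= \Lambda(A).y-\Lambda(B).v+\overline{w \ast x}-\overline{z \ast u},\\ t &= \Lambda^2(A).z-\Lambda^2(B).w+\overline{u \ast y}-\overline{x \ast v}. \end{align*} $\mathbb{H}\subset\mathbb{O}$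 is the subalgebra spanned by $e_0,e_1,e_2,e_3$. $\mathfrak{so}(4)\subset\mathfrak{so}(8)$ is the subalgebra of matrices whose upper left $4\times4$ block is an arbitrary real skew-symmetric matrix and whose other entries vanish. $\mathfrak{sp}(1)^3:=\mathfrak{so}(4)+\lambda(\mathfrak{so}(4))+\lambda^2(\mathfrak{so}(4))$, a subalgebra of $\mathfrak{so}(8)$ isomorphic to $\mathfrak{sp}(1)\oplus\mathfrak{sp}(1)\oplus\mathfrak{sp}(1)$. In $\mathfrak{e}_7$, $\mathfrak{so}(8)$ is the first summand and $\mathfrak{sp}(1)^3$ lies in the second summand of $\mathfrak{so}(8)\oplus\mathfrak{so}(8)$, and $\mathbb{O}\otimes\mathbb{H}\subset\mathbb{O}\otimes\mathbb{O}$. *)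

theory Defs
  imports "HOL-Analysis.Analysis" "HOL-Library.Function_Algebras"
begin

section \<open>Real Lie algebras as subspaces with a bracket\<close>

definition lie_subalgebra ::
  "'a::real_vector set \<Rightarrow> 'a set \<Rightarrow> ('a \<Rightarrow> 'a \<Rightarrow> 'a) \<Rightarrow> bool" where
  "lie_subalgebra S L br \<longleftrightarrow>
     subspace S \<and> S \<subseteq> L \<and> (\<forall>x\<in>S. \<forall>y\<in>S. br x y \<in> S)"

text \<open>The map is linear on the whole ambient type; every linear map defined on the subspace
  \<open>S\<close> has such an extension, so this is no restriction.\<close>

definition lie_isomorphic ::
  "'a::real_vector set \<Rightarrow> ('a \<Rightarrow> 'a \<Rightarrow> 'a) \<Rightarrow>
   'b::real_vector set \<Rightarrow> ('b \<Rightarrow> 'b \<Rightarrow> 'b) \<Rightarrow> bool" where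
  "lie_isomorphic S br T br' \<longleftrightarrow>
     (\<exists>f. linear f \<and> bij_betw f S T \<and> (\<forall>x\<in>S. \<forall>y\<in>S. f (br x y) = br' (f x) (f y)))"


section \<open>Octonions\<close>

text \<open>The elements of the index type \<open>8\<close> are \<open>0, \<dots>, 7\<close> (in particular \<open>8 = 0\<close> there), so that
  \<open>oct_e i\<close> is the basis vector $e_i$, with $e_0$ the identity.\<close>

type_synonym oct = "real ^ 8"
type_synonym mat8 = "real ^ 8 ^ 8"

abbreviation oct_e :: "8 \<Rightarrow> oct" where
  "oct_e i \<equiv> axis i 1"

text \<open>The triples \<open>(i, j, k)\<close> with $e_i e_j = e_k$, closed under cyclic permutation.\<close>

definition oct_triples :: "(8 \<times> 8 \<times> 8) set" where
  "oct_triples =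
     (\<Union>(i, j, k) \<in> {(1,2,3), (1,4,5), (2,4,6), (3,4,7), (5,3,6), (6,1,7), (7,2,5)}.
        {(i, j, k), (j, k, i), (k, i, j)})"

text \<open>\<open>oct_sc i j k\<close> is the coefficient of $e_k$ in $e_i e_j$.\<close>

definition oct_sc :: "8 \<Rightarrow> 8 \<Rightarrow> 8 \<Rightarrow> real" where
  "oct_sc i j k =
     (if i = 0 then of_bool (k = j)
      else if j = 0 then of_bool (k = i)
      else if i = j then - of_bool (k = 0)
      else of_bool ((i, j, k) \<in> oct_triples) - of_bool ((j, i, k) \<in> oct_triples))"

definition oct_mult :: "oct \<Rightarrow> oct \<Rightarrow> oct" (infixl "\<cdot>\<^sub>O" 70) where
  "x \<cdot>\<^sub>O y = (\<chi> k. \<Sum>i\<in>UNIV. \<Sum>j\<in>UNIV. x $ i * y $ j * oct_sc i j k)"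

lemma exhaust_8:
  fixes i :: 8
  shows "i = 0 \<or> i = 1 \<or> i = 2 \<or> i = 3 \<or> i = 4 \<or> i = 5 \<or> i = 6 \<or> i = 7"
proof (induct i)
  case (of_int z)
  then have "z = 0 \<or> z = 1 \<or> z = 2 \<or> z = 3 \<or> z = 4 \<or> z = 5 \<or> z = 6 \<or> z = 7"
    by fastforce
  then show ?case by auto
qed

lemma UNIV_8: "UNIV = {0, 1, 2, 3, 4, 5, 6, 7 :: 8}"
  using exhaust_8 by auto

lemma sum_8: "(\<Sum>i\<in>UNIV. f (i::8)) = f 0 + f 1 + f 2 + f 3 + f 4 + f 5 + f 6 + f 7"
  unfolding UNIV_8 by (simp add: ac_simps)

lemma forall_8: "(\<forall>i::8. P i) \<longleftrightarrow> P 0 \<and> P 1 \<and> P 2 \<and> P 3 \<and> P 4 \<and> P 5 \<and> P 6 \<and> P 7"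
  by (metis exhaust_8)

lemma distinct_8: "distinct [0, 1, 2, 3, 4, 5, 6, 7 :: 8]"
  by simp

lemma neq_8:
  "(0::8) \<noteq> 1" "(0::8) \<noteq> 2" "(0::8) \<noteq> 3" "(0::8) \<noteq> 4" "(0::8) \<noteq> 5" "(0::8) \<noteq> 6" "(0::8) \<noteq> 7"
  "(1::8) \<noteq> 0" "(1::8) \<noteq> 2" "(1::8) \<noteq> 3" "(1::8) \<noteq> 4" "(1::8) \<noteq> 5" "(1::8) \<noteq> 6" "(1::8) \<noteq> 7"
  "(2::8) \<noteq> 0" "(2::8) \<noteq> 1" "(2::8) \<noteq> 3" "(2::8) \<noteq> 4" "(2::8) \<noteq> 5" "(2::8) \<noteq> 6" "(2::8) \<noteq> 7"
  "(3::8) \<noteq> 0" "(3::8) \<noteq> 1" "(3::8) \<noteq> 2" "(3::8) \<noteq> 4" "(3::8) \<noteq> 5" "(3::8) \<noteq> 6" "(3::8) \<noteq> 7"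
  "(4::8) \<noteq> 0" "(4::8) \<noteq> 1" "(4::8) \<noteq> 2" "(4::8) \<noteq> 3" "(4::8) \<noteq> 5" "(4::8) \<noteq> 6" "(4::8) \<noteq> 7"
  "(5::8) \<noteq> 0" "(5::8) \<noteq> 1" "(5::8) \<noteq> 2" "(5::8) \<noteq> 3" "(5::8) \<noteq> 4" "(5::8) \<noteq> 6" "(5::8) \<noteq> 7"
  "(6::8) \<noteq> 0" "(6::8) \<noteq> 1" "(6::8) \<noteq> 2" "(6::8) \<noteq> 3" "(6::8) \<noteq> 4" "(6::8) \<noteq> 5" "(6::8) \<noteq> 7"
  "(7::8) \<noteq> 0" "(7::8) \<noteq> 1" "(7::8) \<noteq> 2" "(7::8) \<noteq> 3" "(7::8) \<noteq> 4" "(7::8) \<noteq> 5" "(7::8) \<noteq> 6"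
  using distinct_8
  by (simp_all only: distinct.simps list.set insert_iff empty_iff de_Morgan_disj simp_thms
      neq_commute)

lemma lessThan_8:
  "{..<0::8} = {}" "{..<1::8} = {0}" "{..<2::8} = {0, 1}" "{..<3::8} = {0, 1, 2}"
  "{..<4::8} = {0, 1, 2, 3}" "{..<5::8} = {0, 1, 2, 3, 4}" "{..<6::8} = {0, 1, 2, 3, 4, 5}"
  "{..<7::8} = {0, 1, 2, 3, 4, 5, 6}"
  by (simp_all only: set_eq_iff forall_8 lessThan_iff insert_iff empty_iff neq_8 simp_thms)
    (simp_all add: less_bit0_def bit0.Rep_numeral bit0.Rep_0 bit0.Rep_1)

lemma oct_triples_iff: "(i, j, k) \<in> oct_triples \<longleftrightarrow>
  (if i = 1 then (if j = 2 then k = 3 else if j = 4 then k = 5 else if j = 7 then k = 6 else False)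
      else if i = 2 then (if j = 3 then k = 1 else if j = 4 then k = 6 else if j = 5 then k = 7 else False)
      else if i = 3 then (if j = 1 then k = 2 else if j = 4 then k = 7 else if j = 6 then k = 5 else False)
      else if i = 4 then (if j = 5 then k = 1 else if j = 6 then k = 2 else if j = 7 then k = 3 else False)
      else if i = 5 then (if j = 1 then k = 4 else if j = 3 then k = 6 else if j = 7 then k = 2 else False)
      else if i = 6 then (if j = 1 then k = 7 else if j = 2 then k = 4 else if j = 5 then k = 3 else False)
      else if i = 7 then (if j = 2 then k = 5 else if j = 3 then k = 4 else if j = 6 then k = 1 else False)
      else False)"
  unfolding oct_triples_def by auto

lemma oct_mult_nth:
  "(x \<cdot>\<^sub>O y) $ 0 = x$0*y$0 - x$1*y$1 - x$2*y$2 - x$3*y$3 - x$4*y$4 - x$5*y$5 - x$6*y$6 - x$7*y$7"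
  "(x \<cdot>\<^sub>O y) $ 1 = x$0*y$1 + x$1*y$0 + x$2*y$3 - x$3*y$2 + x$4*y$5 - x$5*y$4 - x$6*y$7 + x$7*y$6"
  "(x \<cdot>\<^sub>O y) $ 2 = x$0*y$2 - x$1*y$3 + x$2*y$0 + x$3*y$1 + x$4*y$6 + x$5*y$7 - x$6*y$4 - x$7*y$5"
  "(x \<cdot>\<^sub>O y) $ 3 = x$0*y$3 + x$1*y$2 - x$2*y$1 + x$3*y$0 + x$4*y$7 - x$5*y$6 + x$6*y$5 - x$7*y$4"
  "(x \<cdot>\<^sub>O y) $ 4 = x$0*y$4 - x$1*y$5 - x$2*y$6 - x$3*y$7 + x$4*y$0 + x$5*y$1 + x$6*y$2 + x$7*y$3"
  "(x \<cdot>\<^sub>O y) $ 5 = x$0*y$5 + x$1*y$4 - x$2*y$7 + x$3*y$6 - x$4*y$1 + x$5*y$0 - x$6*y$3 + x$7*y$2"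
  "(x \<cdot>\<^sub>O y) $ 6 = x$0*y$6 + x$1*y$7 + x$2*y$4 - x$3*y$5 - x$4*y$2 + x$5*y$3 + x$6*y$0 - x$7*y$1"
  "(x \<cdot>\<^sub>O y) $ 7 = x$0*y$7 - x$1*y$6 + x$2*y$5 + x$3*y$4 - x$4*y$3 - x$5*y$2 + x$6*y$1 + x$7*y$0"
  unfolding oct_mult_def vec_lambda_beta sum_8 oct_sc_def oct_triples_iff
  by (simp_all only: neq_8 refl if_True if_False of_bool_eq mult_zero_right mult_1_right add_0_left add_0_right
      diff_0 diff_0_right diff_self mult_minus_right minus_zero)

lemma oct_alternative:
  "x \<cdot>\<^sub>O (x \<cdot>\<^sub>O y) = (x \<cdot>\<^sub>O x) \<cdot>\<^sub>O y"
  "(y \<cdot>\<^sub>O x) \<cdot>\<^sub>O x = y \<cdot>\<^sub>O (x \<cdot>\<^sub>O x)"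
  unfolding vec_eq_iff forall_8 oct_mult_nth
  by (intro conjI; simp only: algebra_simps)+

definition oct_cnj :: "oct \<Rightarrow> oct" where
  "oct_cnj x = (\<chi> i. if i = 0 then x $ i else - x $ i)"

definition quaternions :: "oct set" where
  "quaternions = span {oct_e 0, oct_e 1, oct_e 2, oct_e 3}"

definition oct_L :: "oct \<Rightarrow> mat8" where
  "oct_L a = matrix (\<lambda>x. a \<cdot>\<^sub>O x)"


section \<open>The Lie algebra so(8) and triality\<close>

definition so8 :: "mat8 set" where
  "so8 = {A. transpose A = - A}"

definition commutator :: "mat8 \<Rightarrow> mat8 \<Rightarrow> mat8" where
  "commutator A B = A ** B - B ** A"

text \<open>\<open>outer x y\<close> is the matrix $x y^t$; it also represents the tensor $x \otimes y$.\<close>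

definition outer :: "oct \<Rightarrow> oct \<Rightarrow> mat8" where
  "outer x y = (\<chi> i j. x $ i * y $ j)"

definition wedge :: "oct \<Rightarrow> oct \<Rightarrow> mat8" where
  "wedge x y = outer x y - outer y x"

text \<open>A skew-symmetric $A$ equals $\sum_{j<i} A_{ij}\, e_i \wedge e_j$. In this sum $i \ge 1$, so
  $e_i$ is purely imaginary, and the prescription
  $\lambda(a \wedge b) = \frac12 L_{\bar b} L_{\bar a}$ applies to each term. For
  all admissible \<open>a\<close>, \<open>b\<close> it is the lemma \<open>triality_wedge\<close> below. Outside \<open>so8\<close> the value is
  irrelevant.\<close>

definition triality :: "mat8 \<Rightarrow> mat8" where
  "triality A = (\<Sum>i\<in>UNIV. \<Sum>j\<in>{..<i}.
     (A $ i $ j / 2) *\<^sub>R (oct_L (oct_cnj (oct_e j)) ** oct_L (oct_cnj (oct_e i))))"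

lemma triality_wedge:
  assumes "a $ 0 = 0" "a \<bullet> b = 0"
  shows "triality (wedge a b) = (1/2) *\<^sub>R (oct_L (oct_cnj b) ** oct_L (oct_cnj a))"
proof -
  have axis: "oct_e i $ j = of_bool (i = j)" for i j :: 8
    by (auto simp: axis_def)
  have L: "oct_L c *v x = c \<cdot>\<^sub>O x" for c x
  proof -
    have "linear (\<lambda>x. c \<cdot>\<^sub>O x)"
      by (rule linearI) (simp_all add: oct_mult_def vec_eq_iff sum.distrib sum_distrib_left
          algebra_simps)
    then show ?thesis unfolding oct_L_def by simp
  qed
  have "triality (wedge a b) *v x
      = (1/2) *\<^sub>R (oct_cnj b \<cdot>\<^sub>O (oct_cnj a \<cdot>\<^sub>O x)) + (a \<bullet> b / 2) *\<^sub>R x" for x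
  proof -
    have c: "oct_cnj y $ 0 = y $ 0" "i \<noteq> 0 \<Longrightarrow> oct_cnj y $ i = - y $ i" for y i
      by (simp_all add: oct_cnj_def)
    note cs = c(1) c(2)[OF neq_8(8)] c(2)[OF neq_8(15)] c(2)[OF neq_8(22)] c(2)[OF neq_8(29)]
      c(2)[OF neq_8(36)] c(2)[OF neq_8(43)] c(2)[OF neq_8(50)]
    note e0 = oct_mult_nth[where x = "oct_cnj (oct_e 0)", unfolded cs axis, simplified]
    note e1 = oct_mult_nth[where x = "oct_cnj (oct_e 1)", unfolded cs axis, simplified]
    note e2 = oct_mult_nth[where x = "oct_cnj (oct_e 2)", unfolded cs axis, simplified]
    note e3 = oct_mult_nth[where x = "oct_cnj (oct_e 3)", unfolded cs axis, simplified]
    note e4 = oct_mult_nth[where x = "oct_cnj (oct_e 4)", unfolded cs axis, simplified]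
    note e5 = oct_mult_nth[where x = "oct_cnj (oct_e 5)", unfolded cs axis, simplified]
    note e6 = oct_mult_nth[where x = "oct_cnj (oct_e 6)", unfolded cs axis, simplified]
    note e7 = oct_mult_nth[where x = "oct_cnj (oct_e 7)", unfolded cs axis, simplified]
    have sum_mv: "(\<Sum>i\<in>S. M i) *v x = (\<Sum>i\<in>S. M i *v x)"
      for S :: "8 set" and M :: "8 \<Rightarrow> mat8"
      by (induction S rule: infinite_finite_induct) (simp_all add: matrix_vector_mult_add_rdistrib)
    have "triality (wedge a b) *v x = (\<Sum>i\<in>UNIV. \<Sum>j\<in>{..<i}.
      ((a $ i * b $ j - b $ i * a $ j) / 2) *\<^sub>R (oct_cnj (oct_e j) \<cdot>\<^sub>O (oct_cnj (oct_e i) \<cdot>\<^sub>O x)))"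
      by (simp add: triality_def wedge_def outer_def sum_mv L
         scaleR_matrix_vector_assoc[symmetric] matrix_vector_mul_assoc[symmetric])
    also have "\<dots> = (1/2) *\<^sub>R (oct_cnj b \<cdot>\<^sub>O (oct_cnj a \<cdot>\<^sub>O x)) + (a \<bullet> b / 2) *\<^sub>R x"
      unfolding vec_eq_iff forall_8 sum_8 lessThan_8
      by (simp add: neq_8 inner_vec_def sum_8 e0 e1 e2 e3 e4 e5 e6 e7)
         (simp add: oct_mult_nth cs assms(1) algebra_simps add_divide_distrib diff_divide_distrib)
    finally show ?thesis .
  qed
  then show ?thesis
    using assms(2)
    by (simp add: matrix_eq L scaleR_matrix_vector_assoc[symmetric] matrix_vector_mul_assoc[symmetric])
qed

definition so4 :: "mat8 set" where
  "so4 = {A \<in> so8. \<forall>i j. i \<notin> {0,1,2,3} \<or> j \<notin> {0,1,2,3} \<longrightarrow> A $ i $ j = 0}"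

definition sp1_cubed :: "mat8 set" where
  "sp1_cubed =
     {A + triality B + triality (triality C) | A B C. A \<in> so4 \<and> B \<in> so4 \<and> C \<in> so4}"


section \<open>Oct-octonions, as 8 by 8 matrices\<close>

definition oo_mult :: "mat8 \<Rightarrow> mat8 \<Rightarrow> mat8" (infixl "\<cdot>\<^sub>O\<^sub>O" 70) where
  "X \<cdot>\<^sub>O\<^sub>O Y = (\<Sum>i\<in>UNIV. \<Sum>j\<in>UNIV. \<Sum>k\<in>UNIV. \<Sum>l\<in>UNIV.
     (X $ i $ j * Y $ k $ l) *\<^sub>R outer (oct_e i \<cdot>\<^sub>O oct_e k) (oct_e j \<cdot>\<^sub>O oct_e l))"

definition oo_cnj :: "mat8 \<Rightarrow> mat8" where
  "oo_cnj X = (\<Sum>i\<in>UNIV. \<Sum>j\<in>UNIV. (X $ i $ j) *\<^sub>R outer (oct_cnj (oct_e i)) (oct_cnj (oct_e j)))"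

lemma oo_mult_outer: "outer a b \<cdot>\<^sub>O\<^sub>O outer c d = outer (a \<cdot>\<^sub>O c) (b \<cdot>\<^sub>O d)"
proof -
  have e: "(oct_e i \<cdot>\<^sub>O oct_e k) $ m = oct_sc i k m" for i k m
  proof -
    have "(oct_e i \<cdot>\<^sub>O oct_e k) $ m =
      (\<Sum>i'\<in>UNIV. if i' = i then (\<Sum>k'\<in>UNIV. if k' = k then oct_sc i' k' m else 0) else 0)"
      unfolding oct_mult_def vec_lambda_beta
      by (intro sum.cong) (auto simp: axis_def if_distrib[where f="\<lambda>t. t * _"] cong: if_cong)
    then show ?thesis by simp
  qed
  have "(outer a b \<cdot>\<^sub>O\<^sub>O outer c d) $ m $ n = outer (a \<cdot>\<^sub>O c) (b \<cdot>\<^sub>O d) $ m $ n" for m n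
  proof -
    have "(outer a b \<cdot>\<^sub>O\<^sub>O outer c d) $ m $ n =
      (\<Sum>i\<in>UNIV. \<Sum>j\<in>UNIV. \<Sum>k\<in>UNIV. \<Sum>l\<in>UNIV.
        (a $ i * c $ k * oct_sc i k m) * (b $ j * d $ l * oct_sc j l n))"
      by (simp add: oo_mult_def outer_def e algebra_simps)
    also have "\<dots> = (\<Sum>i\<in>UNIV. \<Sum>k\<in>UNIV. \<Sum>j\<in>UNIV. \<Sum>l\<in>UNIV.
        (a $ i * c $ k * oct_sc i k m) * (b $ j * d $ l * oct_sc j l n))"
      by (intro sum.cong refl sum.swap)
    also have "\<dots> = outer (a \<cdot>\<^sub>O c) (b \<cdot>\<^sub>O d) $ m $ n"
      by (simp only: outer_def oct_mult_def vec_lambda_beta sum_distrib_right)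
        (simp only: sum_distrib_left)
    finally show ?thesis .
  qed
  then show ?thesis by (simp add: vec_eq_iff)
qed

lemma oo_cnj_outer: "oo_cnj (outer a b) = outer (oct_cnj a) (oct_cnj b)"
proof -
  define s :: "8 \<Rightarrow> real" where "s m = (if m = 0 then 1 else -1)" for m
  have c: "oct_cnj x $ m = s m * x $ m" for x m
    by (simp add: oct_cnj_def s_def)
  have d: "(\<Sum>i\<in>UNIV. f i * oct_e i $ m) = f m" for f m
    by (simp add: axis_def if_distrib cong: if_cong)
  have "oo_cnj (outer a b) $ m $ n = outer (oct_cnj a) (oct_cnj b) $ m $ n" for m n
  proof -
    have "oo_cnj (outer a b) $ m $ n = (\<Sum>i\<in>UNIV. \<Sum>j\<in>UNIV.
      (s m * a $ i * oct_e i $ m) * (s n * b $ j * oct_e j $ n))"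
      by (simp add: oo_cnj_def outer_def c algebra_simps)
    also have "\<dots> = (s m * a $ m) * (s n * b $ n)"
      unfolding sum_product[symmetric] d ..
    finally show ?thesis by (simp add: outer_def c)
  qed
  then show ?thesis by (simp add: vec_eq_iff)
qed

definition oct_tensor_quat :: "mat8 set" where
  "oct_tensor_quat = span {outer x y | x y. y \<in> quaternions}"


section \<open>The compact Lie algebra of type E8 and its subspace e7\<close>

type_synonym so8_pair = "mat8 \<times> mat8"
type_synonym e8 = "so8_pair \<times> mat8 \<times> mat8 \<times> mat8"

definition pair_bracket :: "so8_pair \<Rightarrow> so8_pair \<Rightarrow> so8_pair" where
  "pair_bracket A B = (commutator (fst A) (fst B), commutator (snd A) (snd B))"

definition pair_triality :: "so8_pair \<Rightarrow> so8_pair" where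
  "pair_triality A = (triality (fst A), triality (snd A))"

definition pair_act :: "so8_pair \<Rightarrow> mat8 \<Rightarrow> mat8" where
  "pair_act A X = fst A ** X - X ** snd A"

definition curlywedge :: "mat8 \<Rightarrow> mat8 \<Rightarrow> so8_pair" where
  "curlywedge X Y =
     (X ** transpose Y - Y ** transpose X, transpose X ** Y - transpose Y ** X)"

definition e8_carrier :: "e8 set" where
  "e8_carrier = (so8 \<times> so8) \<times> UNIV \<times> UNIV \<times> UNIV"

fun e8_bracket :: "e8 \<Rightarrow> e8 \<Rightarrow> e8" where
  "e8_bracket (A, u, v, w) (B, x, y, z) =
     (pair_bracket A B
        - 4 *\<^sub>R curlywedge u x
        - 4 *\<^sub>R pair_triality (pair_triality (curlywedge v y))
        - 4 *\<^sub>R pair_triality (curlywedge w z),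
      pair_act A x - pair_act B u + oo_cnj (v \<cdot>\<^sub>O\<^sub>O z) - oo_cnj (y \<cdot>\<^sub>O\<^sub>O w),
      pair_act (pair_triality A) y - pair_act (pair_triality B) v
        + oo_cnj (w \<cdot>\<^sub>O\<^sub>O x) - oo_cnj (z \<cdot>\<^sub>O\<^sub>O u),
      pair_act (pair_triality (pair_triality A)) z - pair_act (pair_triality (pair_triality B)) w
        + oo_cnj (u \<cdot>\<^sub>O\<^sub>O y) - oo_cnj (x \<cdot>\<^sub>O\<^sub>O v))"

definition e7_subspace :: "e8 set" where
  "e7_subspace =
     (so8 \<times> sp1_cubed) \<times> oct_tensor_quat \<times> oct_tensor_quat \<times> oct_tensor_quat"


section \<open>The Lie algebra of the compact group of type E7\<close>

text \<open>The pointwise real vector space structure on functions, which the library does not provide.\<close>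

instantiation "fun" :: (type, real_vector) real_vector
begin

definition scaleR_fun :: "real \<Rightarrow> ('a \<Rightarrow> 'b) \<Rightarrow> 'a \<Rightarrow> 'b" where
  "scaleR_fun c f = (\<lambda>x. c *\<^sub>R f x)"

instance
  by standard (simp_all add: scaleR_fun_def fun_eq_iff scaleR_add_right scaleR_add_left)

end

text \<open>The Lie algebra of the compact Lie group of type $E_7$ is, up to isomorphism, the compact
  real form of the complex simple Lie algebra with Cartan matrix $E_7$. That complex Lie algebra is
  built here from its Cartan matrix \<open>A\<close>, uniformly for all symmetric (simply laced) Cartan
  matrices of finite type (Frenkel-Kac; see Kac, Infinite-dimensional Lie algebras, 7.8). Elements
  of the root lattice are given by their coordinates with respect to the simple roots; the
  invariant form is normalised by $(\alpha,\alpha) = 2$ for roots, and the roots are exactly the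
  lattice vectors of norm 2.\<close>

definition lattice_form :: "int ^ 'n ^ 'n \<Rightarrow> int ^ 'n \<Rightarrow> int ^ 'n \<Rightarrow> int" where
  "lattice_form A a b = (\<Sum>i\<in>UNIV. \<Sum>j\<in>UNIV. a $ i * A $ i $ j * b $ j)"

definition roots :: "int ^ 'n ^ 'n \<Rightarrow> (int ^ 'n) set" where
  "roots A = {a. lattice_form A a a = 2}"

text \<open>The sign \<open>root_sign\<close> is bimultiplicative, and
  $\varepsilon(\alpha,\alpha) = (-1)^{(\alpha,\alpha)/2}$.\<close>

definition root_sign ::
  "int ^ ('n::{finite,linorder}) ^ ('n::{finite,linorder}) \<Rightarrow>
   int ^ ('n::{finite,linorder}) \<Rightarrow> int ^ ('n::{finite,linorder}) \<Rightarrow> complex" where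
  "root_sign A a b =
     (if even ((\<Sum>i\<in>UNIV. a $ i * b $ i) + (\<Sum>i\<in>UNIV. \<Sum>j\<in>{i<..}. a $ i * A $ i $ j * b $ j))
      then 1 else -1)"

text \<open>\<open>(h, x)\<close> stands for $\sum_i h_i \alpha_i + \sum_\alpha x_\alpha E_\alpha$, where the Cartan
  subalgebra is identified with its dual by the invariant form, so that the simple coroots become
  the simple roots $\alpha_i$. The bracket is the bilinear extension of $[h, h'] = 0$,
  $[h, E_\alpha] = (\alpha, h) E_\alpha$, $[E_\alpha, E_{-\alpha}] = -\alpha$,
  $[E_\alpha, E_\beta] = \varepsilon(\alpha,\beta) E_{\alpha+\beta}$ if $\alpha + \beta$ is a root, and
  $[E_\alpha, E_\beta] = 0$ if $\alpha + \beta$ is neither a root nor $0$.\<close>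

type_synonym 'n chevalley = "(complex ^ 'n) \<times> (int ^ 'n \<Rightarrow> complex)"

definition root_value :: "int ^ 'n ^ 'n \<Rightarrow> int ^ 'n \<Rightarrow> complex ^ 'n \<Rightarrow> complex" where
  "root_value A a h = (\<Sum>i\<in>UNIV. \<Sum>j\<in>UNIV. of_int (a $ i * A $ i $ j) * h $ j)"

fun chevalley_bracket ::
  "int ^ ('n::{finite,linorder}) ^ ('n::{finite,linorder}) \<Rightarrow>
   ('n::{finite,linorder}) chevalley \<Rightarrow> ('n::{finite,linorder}) chevalley \<Rightarrow>
   ('n::{finite,linorder}) chevalley" where
  "chevalley_bracket A (h, x) (k, y) =
     ((\<chi> i. - (\<Sum>a\<in>roots A. x a * y (- a) * of_int (a $ i))),
      (\<lambda>c. if c \<in> roots A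
           then root_value A c h * y c - root_value A c k * x c
             + (\<Sum>a | a \<in> roots A \<and> c - a \<in> roots A. root_sign A a (c - a) * x a * y (c - a))
           else 0))"

text \<open>The fixed points of the antilinear involution which maps each simple root (an element of the
  Cartan subalgebra) to its negative and $E_\alpha$ to $E_{-\alpha}$. For finite type, the invariant
  form given by $(E_\alpha, E_{-\alpha}) = -1$ is negative definite on them.\<close>

definition compact_form :: "int ^ 'n ^ 'n \<Rightarrow> 'n::finite chevalley set" where
  "compact_form A =
     {(h, x). (\<forall>i. h $ i = - cnj (h $ i)) \<and> (\<forall>a. x (- a) = cnj (x a)) \<and>
              (\<forall>a. a \<notin> roots A \<longrightarrow> x a = 0)}"

text \<open>The Dynkin diagram is the chain 0, 2, 3, 4, 5, 6 with the node 1 attached to 3, i.e.\ the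
  labelling of Bourbaki shifted down by one.\<close>

definition cartan_E7 :: "int ^ 7 ^ 7" where
  "cartan_E7 = (\<chi> i j.
     if i = j then 2
     else if (i, j) \<in> {(0,2), (2,3), (3,4), (4,5), (5,6), (1,3)} \<or>
             (j, i) \<in> {(0,2), (2,3), (3,4), (4,5), (5,6), (1,3)} then -1
     else 0)"

definition compact_E7 :: "7 chevalley set" where
  "compact_E7 = compact_form cartan_E7"

definition compact_E7_bracket :: "7 chevalley \<Rightarrow> 7 chevalley \<Rightarrow> 7 chevalley" where
  "compact_E7_bracket = chevalley_bracket cartan_E7"

end

theory Submission
  imports Defs
begin

text \<open>The vectors $e_{2a} \pm i e_{2a+1}$ form a common weight basis of the three
  eight-dimensional representations of $\mathfrak{so}(8)$. In it triality permutes root vectors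
  up to sign, octonion multiplication has only coefficients $0, \pm 1$, and the weight vectors
  of $\mathfrak{e}_7$ outside its seven-dimensional Cartan subalgebra are exactly 126 root
  vectors: $24$ in $\mathfrak{so}(8)$, $6$ in $\mathfrak{sp}(1)^3$ and $3 \cdot 32$ in
  $(\mathbb{O} \otimes \mathbb{H})^3$. With the right signs their structure constants are those
  of the Chevalley basis of $E_7$, which is verified root by root. The roots of $E_7$ themselves
  are found from seven mutually orthogonal roots: the inner products $n_i$ of a root with these
  satisfy $\sum_i n_i^2 = 4$.\<close>

section \<open>Weight coordinates of matrices\<close>

text \<open>The pairs (0,1), (2,3), (4,5), (6,7) are not arbitrary: in each of them the product of
  the two basis octonions is $e_1$ up to sign, so multiplication by $e_1$ preserves the four
  coordinate planes. As \<open>triality_nth\<close> shows, triality then maps block diagonal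
  matrices to block diagonal ones, so a single Cartan subalgebra serves all three representations.
  The algebra is real while its root vectors are complex. Instead of complexifying it, a real matrix
  is described by complex coordinates \<open>wt X p q\<close> that satisfy a reality condition under
  \<open>bar\<close>; this is the condition that cuts the compact form out of the complex algebra.
  Closure and the homomorphism property both become polynomial identities in these coordinates. The
  signs in the table have to match \<open>root_sign\<close> for all pairs of roots at once, which is
  why the scales are part of the data and the identities are checked explicitly.\<close>

definition bar :: "8 \<Rightarrow> 8" where
  "bar p = (if p \<in> {0,2,4,6} then p + 1 else p - 1)"

lemma bar_simps [simp]:
  "bar 0 = 1" "bar 1 = 0" "bar 2 = 3" "bar 3 = 2" "bar 4 = 5" "bar 5 = 4" "bar 6 = 7" "bar 7 = 6"
  by (simp_all add: bar_def)

lemma bar_bar [simp]: "bar (bar p) = p"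
  using exhaust_8[of p] by auto

lemma bij_bar: "bij bar"
  by (rule involuntory_imp_bij) simp

lemma sum_bar: "(\<Sum>p\<in>UNIV. f (bar p)) = (\<Sum>p\<in>UNIV. f p)"
  using sum.reindex_bij_betw[OF bij_bar] .

text \<open>\<open>weight p i\<close> is the \<open>i\<close>-th coordinate of $e_{2a} + i e_{2a+1}$ for $p = 2a$ and of its conjugate for
  $p = 2a + 1$; \<open>bar\<close> exchanges the two.\<close>

definition weight :: "8 \<Rightarrow> 8 \<Rightarrow> complex" where
  "weight p i = (if i = p then (if p \<in> {0,2,4,6} then 1 else - \<i>)
                 else if i = bar p then (if p \<in> {0,2,4,6} then \<i> else 1) else 0)"

lemma weight_bar: "weight (bar p) i = cnj (weight p i)"
  using exhaust_8[of p] by (elim disjE) (simp_all add: weight_def)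

lemma weight_orthogonal: "(\<Sum>i\<in>UNIV. weight (bar p) i * weight q i) = (if p = q then 2 else 0)"
proof -
  have "\<forall>p q. (\<Sum>i\<in>UNIV. weight (bar p) i * weight q i) = (if p = q then 2 else 0)"
    unfolding forall_8 sum_8 by (simp add: weight_def neq_8)
  then show ?thesis by blast
qed

lemma weight_complete: "(\<Sum>p\<in>UNIV. weight (bar p) i * weight p j) = (if j = i then 2 else 0)"
proof -
  have "\<forall>i j. (\<Sum>p\<in>UNIV. weight (bar p) i * weight p j) = (if j = i then 2 else 0)"
    unfolding forall_8 sum_8 by (simp add: weight_def neq_8)
  then show ?thesis by blast
qed

lemma sum_swap4:
  "(\<Sum>p\<in>A. \<Sum>q\<in>B. \<Sum>k\<in>C. \<Sum>l\<in>D. f p q k l) = (\<Sum>k\<in>C. \<Sum>l\<in>D. \<Sum>p\<in>A. \<Sum>q\<in>B. f p q k l)"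
proof -
  have "(\<Sum>p\<in>A. \<Sum>q\<in>B. \<Sum>k\<in>C. \<Sum>l\<in>D. f p q k l) = (\<Sum>p\<in>A. \<Sum>k\<in>C. \<Sum>q\<in>B. \<Sum>l\<in>D. f p q k l)"
    by (intro sum.cong refl sum.swap)
  also have "\<dots> = (\<Sum>k\<in>C. \<Sum>p\<in>A. \<Sum>q\<in>B. \<Sum>l\<in>D. f p q k l)"
    by (rule sum.swap)
  also have "\<dots> = (\<Sum>k\<in>C. \<Sum>p\<in>A. \<Sum>l\<in>D. \<Sum>q\<in>B. f p q k l)"
    by (intro sum.cong refl sum.swap)
  also have "\<dots> = (\<Sum>k\<in>C. \<Sum>l\<in>D. \<Sum>p\<in>A. \<Sum>q\<in>B. f p q k l)"
    by (intro sum.cong refl sum.swap)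
  finally show ?thesis .
qed

lemma sum_product_scaled:
  fixes c :: "'a::comm_semiring_0"
  shows "(\<Sum>p\<in>A. a p) * (\<Sum>q\<in>B. b q) * c = (\<Sum>p\<in>A. \<Sum>q\<in>B. a p * b q * c)"
  unfolding sum_product by (simp only: sum_distrib_right)

lemma sum_double_delta:
  fixes x :: "'a::finite \<Rightarrow> 'b::finite \<Rightarrow> complex"
  shows "(\<Sum>k\<in>UNIV. \<Sum>l\<in>UNIV. (if k = i then 2 else 0) * (if l = j then 2 else 0) * x k l) = 4 * x i j"
proof -
  have "(\<Sum>l\<in>UNIV. (if k = i then 2 else 0) * (if l = j then 2 else 0) * x k l)
      = (if k = i then 4 * x k j else 0)" for k
  proof -
    have "(\<Sum>l\<in>UNIV. (if k = i then 2 else 0) * (if l = j then 2 else 0) * x k l)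
        = (\<Sum>l\<in>UNIV. if l = j then if k = i then 4 * x k l else 0 else 0)"
      by (intro sum.cong) auto
    then show ?thesis by simp
  qed
  then show ?thesis by simp
qed

text \<open>With weight vectors $f_p$ this is $f_p^t X f_q$, without complex conjugation, so that
  the weights of the two indices add. The vectors $f_p$ are isotropic and $f_p$ is paired with its
  conjugate, so \<open>bar\<close> appears wherever an index is contracted.\<close>

definition wt :: "mat8 \<Rightarrow> 8 \<Rightarrow> 8 \<Rightarrow> complex" where
  "wt X p q = (\<Sum>i\<in>UNIV. \<Sum>j\<in>UNIV. weight p i * weight q j * of_real (X $ i $ j))"

lemma wt_linear [simp]:
  "wt (X + Y) p q = wt X p q + wt Y p q"
  "wt (X - Y) p q = wt X p q - wt Y p q"
  "wt (- X) p q = - wt X p q"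
  "wt (c *\<^sub>R X) p q = of_real c * wt X p q"
  "wt 0 p q = 0"
  by (simp_all add: wt_def algebra_simps sum.distrib sum_subtractf sum_negf sum_distrib_left)

lemma wt_transpose: "wt (transpose X) p q = wt X q p"
  unfolding wt_def transpose_def by (subst sum.swap) (simp add: mult.commute)

lemma wt_bar: "wt X (bar p) (bar q) = cnj (wt X p q)"
  by (simp add: wt_def weight_bar)

text \<open>Completeness of the weight vectors is applied in each index; each application
  contributes a factor 2, hence the 4.\<close>

lemma wt_inverse:
  "of_real (X $ i $ j) = (\<Sum>p\<in>UNIV. \<Sum>q\<in>UNIV. weight (bar p) i * weight (bar q) j * wt X p q) / 4"
proof -
  have "(\<Sum>p\<in>UNIV. \<Sum>q\<in>UNIV. weight (bar p) i * weight (bar q) j * wt X p q)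
      = (\<Sum>p\<in>UNIV. \<Sum>q\<in>UNIV. \<Sum>k\<in>UNIV. \<Sum>l\<in>UNIV.
          (weight (bar p) i * weight p k) * (weight (bar q) j * weight q l) * of_real (X $ k $ l))"
    by (simp only: wt_def sum_distrib_left) (simp only: mult_ac)
  also have "\<dots> = (\<Sum>k\<in>UNIV. \<Sum>l\<in>UNIV. \<Sum>p\<in>UNIV. \<Sum>q\<in>UNIV.
          (weight (bar p) i * weight p k) * (weight (bar q) j * weight q l) * of_real (X $ k $ l))"
    by (rule sum_swap4)
  also have "\<dots> = (\<Sum>k\<in>UNIV. \<Sum>l\<in>UNIV. (\<Sum>p\<in>UNIV. weight (bar p) i * weight p k)
      * (\<Sum>q\<in>UNIV. weight (bar q) j * weight q l) * of_real (X $ k $ l))"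
    by (simp only: sum_product_scaled)
  also have "\<dots> = 4 * of_real (X $ i $ j)"
    by (simp only: weight_complete sum_double_delta)
  finally show ?thesis by simp
qed

lemma wt_eqI:
  assumes "\<And>p q. wt X p q = wt Y p q"
  shows "X = Y"
  unfolding vec_eq_iff
proof (intro allI)
  fix i j
  show "X $ i $ j = Y $ i $ j"
    by (simp only: of_real_eq_iff[where 'a = complex, symmetric] wt_inverse assms)
qed

text \<open>The identity matrix, written as half the sum of $f_k$ with its conjugate, is inserted
  between the two factors.\<close>

lemma wt_mult: "wt (X ** Y) p q = (\<Sum>k\<in>UNIV. wt X p (bar k) * wt Y k q) / 2"
proof -
  let ?f = "\<lambda>k i l m j. (weight (bar k) l * weight k m)
    * (weight p i * weight q j * of_real (X $ i $ l * Y $ m $ j))"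
  have "(\<Sum>k\<in>UNIV. wt X p (bar k) * wt Y k q)
     = (\<Sum>k\<in>UNIV. \<Sum>i\<in>UNIV. \<Sum>l\<in>UNIV. \<Sum>m\<in>UNIV. \<Sum>j\<in>UNIV. ?f k i l m j)"
    unfolding wt_def by (simp only: sum_distrib_right, simp only: sum_distrib_left) (simp add: mult_ac)
  also have "\<dots> = (\<Sum>i\<in>UNIV. \<Sum>k\<in>UNIV. \<Sum>l\<in>UNIV. \<Sum>m\<in>UNIV. \<Sum>j\<in>UNIV. ?f k i l m j)"
    by (rule sum.swap)
  also have "\<dots> = (\<Sum>i\<in>UNIV. \<Sum>m\<in>UNIV. \<Sum>j\<in>UNIV. \<Sum>k\<in>UNIV. \<Sum>l\<in>UNIV. ?f k i l m j)"
    by (intro sum.cong refl sum_swap4)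
  also have "\<dots> = (\<Sum>i\<in>UNIV. \<Sum>m\<in>UNIV. \<Sum>j\<in>UNIV. \<Sum>l\<in>UNIV. \<Sum>k\<in>UNIV. ?f k i l m j)"
    by (intro sum.cong refl sum.swap)
  also have "\<dots> = (\<Sum>i\<in>UNIV. \<Sum>m\<in>UNIV. \<Sum>j\<in>UNIV. \<Sum>l\<in>UNIV.
      if m = l then 2 * (weight p i * weight q j * of_real (X $ i $ l * Y $ m $ j)) else 0)"
    by (intro sum.cong refl) (simp only: sum_distrib_right[symmetric] weight_complete, simp)
  also have "\<dots> = 2 * (\<Sum>i\<in>UNIV. \<Sum>m\<in>UNIV. \<Sum>j\<in>UNIV. weight p i * weight q j * of_real (X $ i $ m * Y $ m $ j))"
    by (simp add: sum_distrib_left)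
  also have "\<dots> = 2 * (\<Sum>i\<in>UNIV. \<Sum>j\<in>UNIV. \<Sum>m\<in>UNIV. weight p i * weight q j * of_real (X $ i $ m * Y $ m $ j))"
    by (intro arg_cong[where f="\<lambda>x. 2 * x"] sum.cong refl sum.swap)
  also have "\<dots> = 2 * wt (X ** Y) p q"
    by (simp add: wt_def matrix_matrix_mult_def sum_distrib_left)
  finally show ?thesis by simp
qed

definition unwt :: "(8 \<Rightarrow> 8 \<Rightarrow> complex) \<Rightarrow> mat8" where
  "unwt W = (\<chi> i j. Re ((\<Sum>p\<in>UNIV. \<Sum>q\<in>UNIV. weight (bar p) i * weight (bar q) j * W p q) / 4))"

text \<open>The hypothesis makes the sum in \<open>unwt\<close> real, so that taking
  \<open>Re\<close> loses nothing; after that orthogonality of the weight vectors applies.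
  Reindexing both sums by \<open>bar\<close> exhibits the reality.\<close>

lemma wt_unwt:
  assumes "\<And>p q. W (bar p) (bar q) = cnj (W p q)"
  shows "wt (unwt W) p q = W p q"
proof -
  have r: "of_real (Re z) = z" if "cnj z = z" for z
    using that by (simp add: complex_eq_iff)
  have "cnj (\<Sum>p\<in>UNIV. \<Sum>q\<in>UNIV. weight (bar p) i * weight (bar q) j * W p q)
      = (\<Sum>p\<in>UNIV. \<Sum>q\<in>UNIV. weight (bar p) i * weight (bar q) j * W p q)" for i j
  proof -
    have "cnj (\<Sum>p\<in>UNIV. \<Sum>q\<in>UNIV. weight (bar p) i * weight (bar q) j * W p q)
      = (\<Sum>p\<in>UNIV. \<Sum>q\<in>UNIV. weight p i * weight q j * W (bar p) (bar q))"
      by (simp add: weight_bar assms)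
    also have "\<dots> = (\<Sum>p\<in>UNIV. \<Sum>q\<in>UNIV. weight (bar p) i * weight q j * W p (bar q))"
      by (subst sum_bar[symmetric]) simp
    also have "\<dots> = (\<Sum>p\<in>UNIV. \<Sum>q\<in>UNIV. weight (bar p) i * weight (bar q) j * W p q)"
      by (subst (2) sum_bar[symmetric]) simp
    finally show ?thesis .
  qed
  then have r: "of_real (unwt W $ i $ j) =
      (\<Sum>p\<in>UNIV. \<Sum>q\<in>UNIV. weight (bar p) i * weight (bar q) j * W p q) / 4" for i j
    unfolding unwt_def vec_lambda_beta by (intro r) simp
  have "wt (unwt W) p q = (\<Sum>i\<in>UNIV. \<Sum>j\<in>UNIV. \<Sum>k\<in>UNIV. \<Sum>l\<in>UNIV.
      (weight (bar k) i * weight p i) * (weight (bar l) j * weight q j) * (W k l / 4))"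
    by (simp only: wt_def r sum_distrib_left sum_divide_distrib) (simp add: mult_ac)
  also have "\<dots> = (\<Sum>k\<in>UNIV. \<Sum>l\<in>UNIV. \<Sum>i\<in>UNIV. \<Sum>j\<in>UNIV.
      (weight (bar k) i * weight p i) * (weight (bar l) j * weight q j) * (W k l / 4))"
    by (rule sum_swap4)
  also have "\<dots> = (\<Sum>k\<in>UNIV. \<Sum>l\<in>UNIV. (\<Sum>i\<in>UNIV. weight (bar k) i * weight p i)
      * (\<Sum>j\<in>UNIV. weight (bar l) j * weight q j) * (W k l / 4))"
    by (simp only: sum_product_scaled)
  also have "\<dots> = W p q"
    by (simp only: weight_orthogonal sum_double_delta) simp
  finally show ?thesis .
qed

section \<open>Triality and octonion products in weight coordinates\<close>

lemma triality_mv: "triality A *v x = (\<Sum>i\<in>UNIV. \<Sum>j\<in>{..<i}.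
   (A $ i $ j / 2) *\<^sub>R (oct_cnj (oct_e j) \<cdot>\<^sub>O (oct_cnj (oct_e i) \<cdot>\<^sub>O x)))"
proof -
  have L: "oct_L c *v y = c \<cdot>\<^sub>O y" for c y
  proof -
    have "linear (\<lambda>y. c \<cdot>\<^sub>O y)"
      by (rule linearI) (simp_all add: oct_mult_def vec_eq_iff sum.distrib sum_distrib_left
          algebra_simps)
    then show ?thesis unfolding oct_L_def by simp
  qed
  have sum_mv: "(\<Sum>i\<in>S. M i) *v y = (\<Sum>i\<in>S. M i *v y)"
    for S :: "8 set" and M :: "8 \<Rightarrow> mat8" and y
    by (induction S rule: infinite_finite_induct) (simp_all add: matrix_vector_mult_add_rdistrib)
  show ?thesis
    by (simp add: triality_def sum_mv L
         scaleR_matrix_vector_assoc[symmetric] matrix_vector_mul_assoc[symmetric])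
qed

lemma oct_e_nth: "oct_e i $ j = of_bool (i = j)"
  by (auto simp: axis_def)

lemma oct_cnj_nth:
  "oct_cnj y $ 0 = y $ 0" "oct_cnj y $ 1 = - y $ 1" "oct_cnj y $ 2 = - y $ 2"
  "oct_cnj y $ 3 = - y $ 3" "oct_cnj y $ 4 = - y $ 4" "oct_cnj y $ 5 = - y $ 5"
  "oct_cnj y $ 6 = - y $ 6" "oct_cnj y $ 7 = - y $ 7"
  by (simp_all add: oct_cnj_def neq_8)

lemmas oct_cnj_basis_mult =
  oct_mult_nth[where x = "oct_cnj (oct_e 0)", unfolded oct_cnj_nth oct_e_nth, simplified]
  oct_mult_nth[where x = "oct_cnj (oct_e 1)", unfolded oct_cnj_nth oct_e_nth, simplified]
  oct_mult_nth[where x = "oct_cnj (oct_e 2)", unfolded oct_cnj_nth oct_e_nth, simplified]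
  oct_mult_nth[where x = "oct_cnj (oct_e 3)", unfolded oct_cnj_nth oct_e_nth, simplified]
  oct_mult_nth[where x = "oct_cnj (oct_e 4)", unfolded oct_cnj_nth oct_e_nth, simplified]
  oct_mult_nth[where x = "oct_cnj (oct_e 5)", unfolded oct_cnj_nth oct_e_nth, simplified]
  oct_mult_nth[where x = "oct_cnj (oct_e 6)", unfolded oct_cnj_nth oct_e_nth, simplified]
  oct_mult_nth[where x = "oct_cnj (oct_e 7)", unfolded oct_cnj_nth oct_e_nth, simplified]

lemma triality_nth:
  "triality A $ 1 $ 0 = (-A$1$0 + A$3$2 + A$5$4 - A$7$6) / 2"
  "triality A $ 2 $ 0 = (-A$2$0 - A$3$1 + A$6$4 + A$7$5) / 2"
  "triality A $ 3 $ 0 = (A$2$1 - A$3$0 - A$6$5 + A$7$4) / 2"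
  "triality A $ 4 $ 0 = (-A$4$0 - A$5$1 - A$6$2 - A$7$3) / 2"
  "triality A $ 5 $ 0 = (A$4$1 - A$5$0 + A$6$3 - A$7$2) / 2"
  "triality A $ 6 $ 0 = (A$4$2 - A$5$3 - A$6$0 + A$7$1) / 2"
  "triality A $ 7 $ 0 = (A$4$3 + A$5$2 - A$6$1 - A$7$0) / 2"
  "triality A $ 2 $ 1 = (A$2$1 - A$3$0 + A$6$5 - A$7$4) / 2"
  "triality A $ 3 $ 1 = (A$2$0 + A$3$1 + A$6$4 + A$7$5) / 2"
  "triality A $ 4 $ 1 = (A$4$1 - A$5$0 - A$6$3 + A$7$2) / 2"
  "triality A $ 5 $ 1 = (A$4$0 + A$5$1 - A$6$2 - A$7$3) / 2"
  "triality A $ 6 $ 1 = (A$4$3 + A$5$2 + A$6$1 + A$7$0) / 2"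
  "triality A $ 7 $ 1 = (-A$4$2 + A$5$3 - A$6$0 + A$7$1) / 2"
  "triality A $ 3 $ 2 = (-A$1$0 + A$3$2 - A$5$4 + A$7$6) / 2"
  "triality A $ 4 $ 2 = (A$4$2 + A$5$3 - A$6$0 - A$7$1) / 2"
  "triality A $ 5 $ 2 = (-A$4$3 + A$5$2 + A$6$1 - A$7$0) / 2"
  "triality A $ 6 $ 2 = (A$4$0 - A$5$1 + A$6$2 - A$7$3) / 2"
  "triality A $ 7 $ 2 = (A$4$1 + A$5$0 + A$6$3 + A$7$2) / 2"
  "triality A $ 4 $ 3 = (A$4$3 - A$5$2 + A$6$1 - A$7$0) / 2"
  "triality A $ 5 $ 3 = (A$4$2 + A$5$3 + A$6$0 + A$7$1) / 2"
  "triality A $ 6 $ 3 = (-A$4$1 - A$5$0 + A$6$3 + A$7$2) / 2"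
  "triality A $ 7 $ 3 = (A$4$0 - A$5$1 - A$6$2 + A$7$3) / 2"
  "triality A $ 5 $ 4 = (-A$1$0 - A$3$2 + A$5$4 + A$7$6) / 2"
  "triality A $ 6 $ 4 = (-A$2$0 + A$3$1 + A$6$4 - A$7$5) / 2"
  "triality A $ 7 $ 4 = (-A$2$1 - A$3$0 + A$6$5 + A$7$4) / 2"
  "triality A $ 6 $ 5 = (A$2$1 + A$3$0 + A$6$5 + A$7$4) / 2"
  "triality A $ 7 $ 5 = (-A$2$0 + A$3$1 - A$6$4 + A$7$5) / 2"
  "triality A $ 7 $ 6 = (A$1$0 + A$3$2 + A$5$4 + A$7$6) / 2"
proof -
  have "triality A $ k $ m = (triality A *v oct_e m) $ k" for k m
    by (simp add: matrix_vector_mult_basis column_def)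
  note e = this[unfolded triality_mv sum_8 lessThan_8]
  note s = oct_cnj_basis_mult neq_8 oct_e_nth
  show "triality A $ 1 $ 0 = (-A$1$0 + A$3$2 + A$5$4 - A$7$6) / 2"
    unfolding e by (simp add: s)
  show "triality A $ 2 $ 0 = (-A$2$0 - A$3$1 + A$6$4 + A$7$5) / 2"
    unfolding e by (simp add: s)
  show "triality A $ 3 $ 0 = (A$2$1 - A$3$0 - A$6$5 + A$7$4) / 2"
    unfolding e by (simp add: s)
  show "triality A $ 4 $ 0 = (-A$4$0 - A$5$1 - A$6$2 - A$7$3) / 2"
    unfolding e by (simp add: s)
  show "triality A $ 5 $ 0 = (A$4$1 - A$5$0 + A$6$3 - A$7$2) / 2"
    unfolding e by (simp add: s)
  show "triality A $ 6 $ 0 = (A$4$2 - A$5$3 - A$6$0 + A$7$1) / 2"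
    unfolding e by (simp add: s)
  show "triality A $ 7 $ 0 = (A$4$3 + A$5$2 - A$6$1 - A$7$0) / 2"
    unfolding e by (simp add: s)
  show "triality A $ 2 $ 1 = (A$2$1 - A$3$0 + A$6$5 - A$7$4) / 2"
    unfolding e by (simp add: s)
  show "triality A $ 3 $ 1 = (A$2$0 + A$3$1 + A$6$4 + A$7$5) / 2"
    unfolding e by (simp add: s)
  show "triality A $ 4 $ 1 = (A$4$1 - A$5$0 - A$6$3 + A$7$2) / 2"
    unfolding e by (simp add: s)
  show "triality A $ 5 $ 1 = (A$4$0 + A$5$1 - A$6$2 - A$7$3) / 2"
    unfolding e by (simp add: s)
  show "triality A $ 6 $ 1 = (A$4$3 + A$5$2 + A$6$1 + A$7$0) / 2"
    unfolding e by (simp add: s)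
  show "triality A $ 7 $ 1 = (-A$4$2 + A$5$3 - A$6$0 + A$7$1) / 2"
    unfolding e by (simp add: s)
  show "triality A $ 3 $ 2 = (-A$1$0 + A$3$2 - A$5$4 + A$7$6) / 2"
    unfolding e by (simp add: s)
  show "triality A $ 4 $ 2 = (A$4$2 + A$5$3 - A$6$0 - A$7$1) / 2"
    unfolding e by (simp add: s)
  show "triality A $ 5 $ 2 = (-A$4$3 + A$5$2 + A$6$1 - A$7$0) / 2"
    unfolding e by (simp add: s)
  show "triality A $ 6 $ 2 = (A$4$0 - A$5$1 + A$6$2 - A$7$3) / 2"
    unfolding e by (simp add: s)
  show "triality A $ 7 $ 2 = (A$4$1 + A$5$0 + A$6$3 + A$7$2) / 2"
    unfolding e by (simp add: s)
  show "triality A $ 4 $ 3 = (A$4$3 - A$5$2 + A$6$1 - A$7$0) / 2"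
    unfolding e by (simp add: s)
  show "triality A $ 5 $ 3 = (A$4$2 + A$5$3 + A$6$0 + A$7$1) / 2"
    unfolding e by (simp add: s)
  show "triality A $ 6 $ 3 = (-A$4$1 - A$5$0 + A$6$3 + A$7$2) / 2"
    unfolding e by (simp add: s)
  show "triality A $ 7 $ 3 = (A$4$0 - A$5$1 - A$6$2 + A$7$3) / 2"
    unfolding e by (simp add: s)
  show "triality A $ 5 $ 4 = (-A$1$0 - A$3$2 + A$5$4 + A$7$6) / 2"
    unfolding e by (simp add: s)
  show "triality A $ 6 $ 4 = (-A$2$0 + A$3$1 + A$6$4 - A$7$5) / 2"
    unfolding e by (simp add: s)
  show "triality A $ 7 $ 4 = (-A$2$1 - A$3$0 + A$6$5 + A$7$4) / 2"
    unfolding e by (simp add: s)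
  show "triality A $ 6 $ 5 = (A$2$1 + A$3$0 + A$6$5 + A$7$4) / 2"
    unfolding e by (simp add: s)
  show "triality A $ 7 $ 5 = (-A$2$0 + A$3$1 - A$6$4 + A$7$5) / 2"
    unfolding e by (simp add: s)
  show "triality A $ 7 $ 6 = (A$1$0 + A$3$2 + A$5$4 + A$7$6) / 2"
    unfolding e by (simp add: s)
qed

text \<open>This holds for every matrix: the defining sum reads only entries below the diagonal, and
  each of its terms is skew, because left multiplications by distinct imaginary units are skew and
  anticommute.\<close>

lemma triality_so8 [simp]: "triality A \<in> so8"
proof -
  have "triality A $ k $ m = (triality A *v oct_e m) $ k" for k m
    by (simp add: matrix_vector_mult_basis column_def)
  note e = this[unfolded triality_mv sum_8 lessThan_8]
  show ?thesis
    unfolding so8_def mem_Collect_eq vec_eq_iff forall_8 transpose_def vec_lambda_beta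
      uminus_vec_def e
    by (simp add: oct_cnj_basis_mult neq_8 oct_e_nth)
qed

lemma so8_iff_wt: "A \<in> so8 \<longleftrightarrow> (\<forall>p q. wt A q p = - wt A p q)"
proof
  assume "A \<in> so8"
  then have "transpose A = - A" by (simp add: so8_def)
  then show "\<forall>p q. wt A q p = - wt A p q"
    using wt_transpose[of A] by simp
next
  assume w: "\<forall>p q. wt A q p = - wt A p q"
  have "transpose A = - A"
  proof (rule wt_eqI)
    show "wt (transpose A) p q = wt (- A) p q" for p q
      unfolding wt_transpose wt_linear using w by blast
  qed
  then show "A \<in> so8" by (simp add: so8_def)
qed

lemma wt_so8_diag: "A \<in> so8 \<Longrightarrow> wt A p p = 0"
  using so8_iff_wt[THEN iffD1, rule_format, of A p p] by simp

lemma so8_nth: "A \<in> so8 \<Longrightarrow> A $ j $ i = - A $ i $ j"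
proof -
  assume "A \<in> so8"
  then have "transpose A $ i $ j = (- A) $ i $ j" by (simp add: so8_def)
  then show ?thesis by (simp add: transpose_def)
qed

lemma wt_so8:
  assumes "A \<in> so8"
  shows
  "wt A 0 0 = 0"
  "wt A 1 1 = 0"
  "wt A 2 2 = 0"
  "wt A 3 3 = 0"
  "wt A 4 4 = 0"
  "wt A 5 5 = 0"
  "wt A 6 6 = 0"
  "wt A 7 7 = 0"
  "wt A 1 0 = - wt A 0 1"
  "wt A 2 0 = - wt A 0 2"
  "wt A 3 0 = - wt A 0 3"
  "wt A 4 0 = - wt A 0 4"
  "wt A 5 0 = - wt A 0 5"
  "wt A 6 0 = - wt A 0 6"
  "wt A 7 0 = - wt A 0 7"
  "wt A 2 1 = - wt A 1 2"
  "wt A 3 1 = - wt A 1 3"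
  "wt A 4 1 = - wt A 1 4"
  "wt A 5 1 = - wt A 1 5"
  "wt A 6 1 = - wt A 1 6"
  "wt A 7 1 = - wt A 1 7"
  "wt A 3 2 = - wt A 2 3"
  "wt A 4 2 = - wt A 2 4"
  "wt A 5 2 = - wt A 2 5"
  "wt A 6 2 = - wt A 2 6"
  "wt A 7 2 = - wt A 2 7"
  "wt A 4 3 = - wt A 3 4"
  "wt A 5 3 = - wt A 3 5"
  "wt A 6 3 = - wt A 3 6"
  "wt A 7 3 = - wt A 3 7"
  "wt A 5 4 = - wt A 4 5"
  "wt A 6 4 = - wt A 4 6"
  "wt A 7 4 = - wt A 4 7"
  "wt A 6 5 = - wt A 5 6"
  "wt A 7 5 = - wt A 5 7"
  "wt A 7 6 = - wt A 6 7"
  by (rule wt_so8_diag[OF assms] so8_iff_wt[THEN iffD1, rule_format, OF assms])+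

lemma wt_alt: "wt X p q = (\<Sum>i\<in>UNIV. weight p i * (\<Sum>j\<in>UNIV. weight q j * of_real (X $ i $ j)))"
  by (simp add: wt_def sum_distrib_left mult.assoc)

lemma sum_weight:
  "(\<Sum>i\<in>UNIV. weight 0 i * f i) = f 0 + \<i> * f 1"
  "(\<Sum>i\<in>UNIV. weight 1 i * f i) = f 0 - \<i> * f 1"
  "(\<Sum>i\<in>UNIV. weight 2 i * f i) = f 2 + \<i> * f 3"
  "(\<Sum>i\<in>UNIV. weight 3 i * f i) = f 2 - \<i> * f 3"
  "(\<Sum>i\<in>UNIV. weight 4 i * f i) = f 4 + \<i> * f 5"
  "(\<Sum>i\<in>UNIV. weight 5 i * f i) = f 4 - \<i> * f 5"
  "(\<Sum>i\<in>UNIV. weight 6 i * f i) = f 6 + \<i> * f 7"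
  "(\<Sum>i\<in>UNIV. weight 7 i * f i) = f 6 - \<i> * f 7"
  by (simp_all add: sum_8 weight_def neq_8)

lemmas so8_upper =
  so8_nth[where j = 0 and i = 1] so8_nth[where j = 0 and i = 2] so8_nth[where j = 0 and i = 3]
  so8_nth[where j = 0 and i = 4] so8_nth[where j = 0 and i = 5] so8_nth[where j = 0 and i = 6]
  so8_nth[where j = 0 and i = 7] so8_nth[where j = 1 and i = 2] so8_nth[where j = 1 and i = 3]
  so8_nth[where j = 1 and i = 4] so8_nth[where j = 1 and i = 5] so8_nth[where j = 1 and i = 6]
  so8_nth[where j = 1 and i = 7] so8_nth[where j = 2 and i = 3] so8_nth[where j = 2 and i = 4]
  so8_nth[where j = 2 and i = 5] so8_nth[where j = 2 and i = 6] so8_nth[where j = 2 and i = 7]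
  so8_nth[where j = 3 and i = 4] so8_nth[where j = 3 and i = 5] so8_nth[where j = 3 and i = 6]
  so8_nth[where j = 3 and i = 7] so8_nth[where j = 4 and i = 5] so8_nth[where j = 4 and i = 6]
  so8_nth[where j = 4 and i = 7] so8_nth[where j = 5 and i = 6] so8_nth[where j = 5 and i = 7]
  so8_nth[where j = 6 and i = 7]

lemma so8_diag: "A \<in> so8 \<Longrightarrow> A $ i $ i = 0"
  using so8_nth[of A i i] by simp

text \<open>Of the 24 root vectors six are fixed, at (2,5), (2,6), (3,4), (3,7), (4,6), (5,7), and
  the others form six cycles of length three, up to sign. The four Cartan coordinates at (p,
  \<open>bar p\<close>) are mixed by a matrix with entries of absolute value 1/2.\<close>

lemma wt_triality:
  assumes "A \<in> so8"
  shows
  "wt (triality A) 0 1 = (- wt A 0 1 + wt A 2 3 + wt A 4 5 - wt A 6 7) / 2"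
  "wt (triality A) 0 2 = - wt A 1 2"
  "wt (triality A) 0 3 = wt A 4 7"
  "wt (triality A) 0 4 = - wt A 1 4"
  "wt (triality A) 0 5 = - wt A 2 7"
  "wt (triality A) 0 6 = wt A 2 4"
  "wt (triality A) 0 7 = - wt A 1 7"
  "wt (triality A) 1 2 = wt A 5 6"
  "wt (triality A) 1 3 = - wt A 0 3"
  "wt (triality A) 1 4 = - wt A 3 6"
  "wt (triality A) 1 5 = - wt A 0 5"
  "wt (triality A) 1 6 = - wt A 0 6"
  "wt (triality A) 1 7 = wt A 3 5"
  "wt (triality A) 2 3 = (- wt A 0 1 + wt A 2 3 - wt A 4 5 + wt A 6 7) / 2"
  "wt (triality A) 2 4 = - wt A 1 6"
  "wt (triality A) 2 5 = wt A 2 5"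
  "wt (triality A) 2 6 = wt A 2 6"
  "wt (triality A) 2 7 = wt A 1 5"
  "wt (triality A) 3 4 = wt A 3 4"
  "wt (triality A) 3 5 = - wt A 0 7"
  "wt (triality A) 3 6 = wt A 0 4"
  "wt (triality A) 3 7 = wt A 3 7"
  "wt (triality A) 4 5 = (- wt A 0 1 - wt A 2 3 + wt A 4 5 + wt A 6 7) / 2"
  "wt (triality A) 4 6 = wt A 4 6"
  "wt (triality A) 4 7 = - wt A 1 3"
  "wt (triality A) 5 6 = - wt A 0 2"
  "wt (triality A) 5 7 = wt A 5 7"
  "wt (triality A) 6 7 = (wt A 0 1 + wt A 2 3 + wt A 4 5 + wt A 6 7) / 2"
  unfolding wt_alt sum_weight so8_upper[OF triality_so8] so8_upper[OF assms]
    so8_diag[OF triality_so8] so8_diag[OF assms] triality_nth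
  by (simp_all add: complex_eq_iff field_simps)

section \<open>Octonion conjugation and multiplication on weight vectors\<close>

lemma oct_cnj_alt: "oct_cnj x $ i = (if i = 0 then 1 else -1) * x $ i"
  by (simp add: oct_cnj_def)

text \<open>In the first pair conjugation negates only $e_1$ and thereby exchanges the two weight
  vectors; the weight vectors of the other pairs are negated.\<close>

definition cnj_index :: "8 \<Rightarrow> 8" where
  "cnj_index p = (if p = 0 then 1 else if p = 1 then 0 else p)"

definition cnj_sign :: "8 \<Rightarrow> complex" where
  "cnj_sign p = (if p = 0 \<or> p = 1 then 1 else -1)"

lemma weight_cnj: "weight p i * (if i = 0 then 1 else -1) = cnj_sign p * weight (cnj_index p) i"
proof -
  have "\<forall>p i. weight p i * (if i = 0 then 1 else -1) = cnj_sign p * weight (cnj_index p) i"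
    unfolding forall_8 by (simp add: weight_def neq_8 cnj_sign_def cnj_index_def)
  then show ?thesis by blast
qed

lemma oo_cnj_nth: "oo_cnj X $ m $ n = (if m = 0 then 1 else -1) * (if n = 0 then 1 else -1) * X $ m $ n"
proof -
  define s :: "8 \<Rightarrow> real" where "s m = (if m = 0 then 1 else -1)" for m
  have "oo_cnj X $ m $ n = (\<Sum>i\<in>UNIV. \<Sum>j\<in>UNIV. X $ i $ j * (s m * of_bool (i = m) * (s n * of_bool (j = n))))"
    unfolding oo_cnj_def s_def by (simp only: sum_component vector_scaleR_component outer_def
        vec_lambda_beta oct_cnj_alt oct_e_nth real_scaleR_def)
  also have "\<dots> = (\<Sum>i\<in>UNIV. if i = m then s m * s n * X $ i $ n else 0)"
  proof (intro sum.cong refl)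
    fix i
    have "(\<Sum>j\<in>UNIV. X $ i $ j * (s m * of_bool (i = m) * (s n * of_bool (j = n))))
        = (\<Sum>j\<in>UNIV. if j = n then X $ i $ j * (s m * of_bool (i = m) * s n) else 0)"
      by (intro sum.cong) auto
    then show "(\<Sum>j\<in>UNIV. X $ i $ j * (s m * of_bool (i = m) * (s n * of_bool (j = n))))
        = (if i = m then s m * s n * X $ i $ n else 0)"
      by auto
  qed
  finally show ?thesis by (simp add: s_def)
qed

lemma wt_oo_cnj: "wt (oo_cnj X) p q = cnj_sign p * cnj_sign q * wt X (cnj_index p) (cnj_index q)"
proof -
  define s :: "8 \<Rightarrow> complex" where "s m = (if m = 0 then 1 else -1)" for m
  have "of_real (oo_cnj X $ m $ n) = s m * s n * of_real (X $ m $ n)" for m n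
    by (simp add: oo_cnj_nth s_def)
  then have "wt (oo_cnj X) p q = (\<Sum>i\<in>UNIV. \<Sum>j\<in>UNIV. (weight p i * s i) * (weight q j * s j) * of_real (X $ i $ j))"
    by (simp add: wt_def mult_ac)
  also have "\<dots> = cnj_sign p * cnj_sign q * wt X (cnj_index p) (cnj_index q)"
    unfolding s_def weight_cnj by (simp add: wt_def sum_distrib_left mult_ac)
  finally show ?thesis .
qed

definition oct_weight :: "oct \<Rightarrow> 8 \<Rightarrow> complex" where
  "oct_weight x p = (\<Sum>i\<in>UNIV. weight p i * of_real (x $ i))"

text \<open>The octonion multiplication table in the weight basis, with \<open>F a b\<close> in the
  role of the product of coordinate a of the left factor and coordinate b of the right one. As a
  linear functional of \<open>F\<close> it can be nested, once for each factor of the tensor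
  product, as \<open>wt_oo_mult\<close> does. The last pair enters with its two members exchanged,
  since $e_1 e_6 = -e_7$.\<close>

definition mult_form :: "8 \<Rightarrow> (8 \<Rightarrow> 8 \<Rightarrow> complex) \<Rightarrow> complex" where
  "mult_form p F = (
    if p = 0 then F 0 0 - F 2 3 - F 4 5 - F 7 6
    else if p = 1 then F 1 1 - F 3 2 - F 5 4 - F 6 7
    else if p = 2 then F 0 2 + F 2 1 + F 5 6 - F 6 5
    else if p = 3 then F 1 3 + F 3 0 + F 4 7 - F 7 4
    else if p = 4 then F 0 4 - F 3 6 + F 4 1 + F 6 3
    else if p = 5 then F 1 5 - F 2 7 + F 5 0 + F 7 2
    else if p = 6 then F 1 6 + F 2 4 - F 4 2 + F 6 0
    else F 0 7 + F 3 5 - F 5 3 + F 7 1)"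

lemma mult_form_simps:
  "mult_form 0 F = F 0 0 - F 2 3 - F 4 5 - F 7 6"
  "mult_form 1 F = F 1 1 - F 3 2 - F 5 4 - F 6 7"
  "mult_form 2 F = F 0 2 + F 2 1 + F 5 6 - F 6 5"
  "mult_form 3 F = F 1 3 + F 3 0 + F 4 7 - F 7 4"
  "mult_form 4 F = F 0 4 - F 3 6 + F 4 1 + F 6 3"
  "mult_form 5 F = F 1 5 - F 2 7 + F 5 0 + F 7 2"
  "mult_form 6 F = F 1 6 + F 2 4 - F 4 2 + F 6 0"
  "mult_form 7 F = F 0 7 + F 3 5 - F 5 3 + F 7 1"
  by (simp_all add: mult_form_def neq_8)

lemma mult_form_sum: "mult_form p (\<lambda>a b. \<Sum>i\<in>S. F i a b) = (\<Sum>i\<in>S. mult_form p (\<lambda>a b. F i a b))"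
  by (simp add: mult_form_def sum.distrib sum_subtractf sum_negf)

lemma mult_form_scale:
  "mult_form p (\<lambda>a b. c * F a b) = c * mult_form p (\<lambda>a b. F a b)"
  "mult_form p (\<lambda>a b. F a b * c) = mult_form p (\<lambda>a b. F a b) * c"
  by (simp_all add: mult_form_def algebra_simps)

lemma oct_weight_mult:
  "oct_weight (x \<cdot>\<^sub>O y) p = mult_form p (\<lambda>a b. oct_weight x a * oct_weight y b)"
proof -
  have "\<forall>p. oct_weight (x \<cdot>\<^sub>O y) p = mult_form p (\<lambda>a b. oct_weight x a * oct_weight y b)"
    unfolding forall_8 mult_form_simps oct_weight_def sum_weight oct_mult_nth
    by (simp add: complex_eq_iff algebra_simps)
  then show ?thesis by blast
qed

lemma oct_weight_basis: "oct_weight (oct_e i) p = weight p i"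
proof -
  have "oct_weight (oct_e i) p = (\<Sum>j\<in>UNIV. if j = i then weight p j else 0)"
    unfolding oct_weight_def by (intro sum.cong) (auto simp: oct_e_nth)
  then show ?thesis by simp
qed

lemma wt_oo_mult:
  "wt (X \<cdot>\<^sub>O\<^sub>O Y) p q = mult_form p (\<lambda>a b. mult_form q (\<lambda>a' b'. wt X a a' * wt Y b b'))"
proof -
  have wt_sum: "wt (\<Sum>i\<in>S. f i) p q = (\<Sum>i\<in>S. wt (f i) p q)" for S :: "8 set" and f
    by (induction S rule: infinite_finite_induct) simp_all
  have wt_outer: "wt (outer x y) p q = oct_weight x p * oct_weight y q" for x y
    by (simp add: wt_def outer_def oct_weight_def sum_product mult_ac)
  have "wt (X \<cdot>\<^sub>O\<^sub>O Y) p q = (\<Sum>i\<in>UNIV. \<Sum>j\<in>UNIV. \<Sum>k\<in>UNIV. \<Sum>l\<in>UNIV.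
      of_real (X $ i $ j * Y $ k $ l) * (mult_form p (\<lambda>a b. weight a i * weight b k) *
        mult_form q (\<lambda>a' b'. weight a' j * weight b' l)))"
    unfolding oo_mult_def by (simp add: wt_sum wt_outer oct_weight_mult oct_weight_basis)
  also have "\<dots> = mult_form p (\<lambda>a b. mult_form q (\<lambda>a' b'. \<Sum>i\<in>UNIV. \<Sum>j\<in>UNIV. \<Sum>k\<in>UNIV. \<Sum>l\<in>UNIV.
      of_real (X $ i $ j * Y $ k $ l) * ((weight a i * weight b k) * (weight a' j * weight b' l))))"
    by (simp only: mult_form_sum mult_form_scale)
  also have "\<dots> = mult_form p (\<lambda>a b. mult_form q (\<lambda>a' b'. wt X a a' * wt Y b b'))"
  proof -
    have "(\<Sum>i\<in>UNIV. \<Sum>j\<in>UNIV. \<Sum>k\<in>UNIV. \<Sum>l\<in>UNIV.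
      of_real (X $ i $ j * Y $ k $ l) * ((weight a i * weight b k) * (weight a' j * weight b' l)))
      = wt X a a' * wt Y b b'" for a b a' b'
      unfolding wt_def
      by (simp only: sum_distrib_right, simp only: sum_distrib_left) (simp add: mult_ac)
    then show ?thesis by simp
  qed
  finally show ?thesis .
qed

section \<open>The root system of type E7\<close>

lemma exhaust_7:
  fixes i :: 7
  shows "i = 0 \<or> i = 1 \<or> i = 2 \<or> i = 3 \<or> i = 4 \<or> i = 5 \<or> i = 6"
proof (induct i)
  case (of_int z)
  then have "z = 0 \<or> z = 1 \<or> z = 2 \<or> z = 3 \<or> z = 4 \<or> z = 5 \<or> z = 6"
    by fastforce
  then show ?case by auto
qed

lemma UNIV_7: "UNIV = {0, 1, 2, 3, 4, 5, 6 :: 7}"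
  using exhaust_7 by auto

lemma sum_7: "(\<Sum>i\<in>UNIV. f (i::7)) = f 0 + f 1 + f 2 + f 3 + f 4 + f 5 + f 6"
  unfolding UNIV_7 by (simp add: ac_simps)

lemma forall_7: "(\<forall>i::7. P i) \<longleftrightarrow> P 0 \<and> P 1 \<and> P 2 \<and> P 3 \<and> P 4 \<and> P 5 \<and> P 6"
  by (metis exhaust_7)

lemma greaterThan_7:
  "{0::7<..} = {1, 2, 3, 4, 5, 6}" "{1::7<..} = {2, 3, 4, 5, 6}" "{2::7<..} = {3, 4, 5, 6}"
  "{3::7<..} = {4, 5, 6}" "{4::7<..} = {5, 6}" "{5::7<..} = {6}" "{6::7<..} = {}"
  by (simp_all only: set_eq_iff forall_7 greaterThan_iff insert_iff empty_iff)
    (simp_all add: less_bit1_def bit1.Rep_numeral bit1.Rep_0 bit1.Rep_1)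

lemma lattice_form_E7:
  "lattice_form cartan_E7 x y =
     x$0 * (2 * y$0 - y$2) + x$1 * (2 * y$1 - y$3) + x$2 * (2 * y$2 - y$0 - y$3)
     + x$3 * (2 * y$3 - y$1 - y$2 - y$4) + x$4 * (2 * y$4 - y$3 - y$5)
     + x$5 * (2 * y$5 - y$4 - y$6) + x$6 * (2 * y$6 - y$5)"
  unfolding lattice_form_def cartan_E7_def sum_7 by (simp add: algebra_simps)

lemma root_sign_E7:
  "root_sign cartan_E7 x y = (if even (x$0 * (y$0 - y$2) + x$1 * (y$1 - y$3) + x$2 * (y$2 - y$3)
     + x$3 * (y$3 - y$4) + x$4 * (y$4 - y$5) + x$5 * (y$5 - y$6) + x$6 * y$6) then 1 else -1)"
  unfolding root_sign_def cartan_E7_def sum_7 greaterThan_7 by (simp add: algebra_simps)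

lemma root_value_E7:
  "root_value cartan_E7 a h =
     of_int (2 * a$0 - a$2) * h$0 + of_int (2 * a$1 - a$3) * h$1 + of_int (2 * a$2 - a$0 - a$3) * h$2
     + of_int (2 * a$3 - a$1 - a$2 - a$4) * h$3 + of_int (2 * a$4 - a$3 - a$5) * h$4
     + of_int (2 * a$5 - a$4 - a$6) * h$5 + of_int (2 * a$6 - a$5) * h$6"
  unfolding root_value_def cartan_E7_def sum_7 by (simp add: algebra_simps)

text \<open>Lattice vectors are handled as literal lists, so that comparing, negating and
  subtracting roots is plain evaluation.\<close>

definition lattice_vec :: "int list \<Rightarrow> int ^ 7" where
  "lattice_vec l = (\<chi> i. l ! (if i = 0 then 0 else if i = 1 then 1 else if i = 2 then 2 else
     if i = 3 then 3 else if i = 4 then 4 else if i = 5 then 5 else 6))"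

lemma lattice_vec_nth:
  "lattice_vec [a, b, c, d, e, f, g] $ 0 = a" "lattice_vec [a, b, c, d, e, f, g] $ 1 = b"
  "lattice_vec [a, b, c, d, e, f, g] $ 2 = c" "lattice_vec [a, b, c, d, e, f, g] $ 3 = d"
  "lattice_vec [a, b, c, d, e, f, g] $ 4 = e" "lattice_vec [a, b, c, d, e, f, g] $ 5 = f"
  "lattice_vec [a, b, c, d, e, f, g] $ 6 = g"
  by (simp_all add: lattice_vec_def)

lemma lattice_vec_eta: "x = lattice_vec [x$0, x$1, x$2, x$3, x$4, x$5, x$6]"
  unfolding vec_eq_iff forall_7 lattice_vec_nth by simp

lemma lattice_vec_diff:
  "lattice_vec [a, b, c, d, e, f, g] - lattice_vec [a', b', c', d', e', f', g']
   = lattice_vec [a - a', b - b', c - c', d - d', e - e', f - f', g - g']"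
  unfolding vec_eq_iff forall_7 lattice_vec_nth vector_minus_component by simp

lemma lattice_vec_uminus:
  "- lattice_vec [a, b, c, d, e, f, g] = lattice_vec [-a, -b, -c, -d, -e, -f, -g]"
  unfolding vec_eq_iff forall_7 lattice_vec_nth vector_uminus_component by simp

lemma list_7:
  assumes "length l = 7"
  obtains a b c d e f g where "l = [a, b, c, d, e, f, g]"
  using assms by (auto simp: numeral_eq_Suc length_Suc_conv)

lemma inj_lattice_vec: "inj_on lattice_vec {l. length l = 7}"
proof (rule inj_onI, simp)
  fix k l :: "int list"
  assume "length k = 7" "length l = 7" and eq: "lattice_vec k = lattice_vec l"
  then show "k = l"
    using lattice_vec_nth by (elim list_7) (simp add: vec_eq_iff forall_7)
qed

text \<open>The entry \<open>(l, c, p, q, s)\<close> says that the coefficient of the root vector $E_a$, where $a$ has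
  the coordinates \<open>l\<close> with respect to the simple roots, is \<open>s\<close> times the weight coordinate \<open>(p, q)\<close>
  of the \<open>c\<close>-th component of an element of $\mathfrak{e}_7$ (components: $\mathfrak{so}(8)$,
  $\mathfrak{sp}(1)^3$ and the three copies of $\mathbb{O} \otimes \mathbb{H}$). A system of simple
  roots for the Cartan subalgebra of block diagonal matrices determines \<open>l\<close>. The absolute value of
  \<open>s\<close> comes from $[E_a, E_{-a}] = -a$; its sign is found by induction on the height, by comparing
  the structure constants with \<open>root_sign\<close>.\<close>

definition e7_so8_table :: "(int list \<times> nat \<times> 8 \<times> 8 \<times> real) list" where
  "e7_so8_table = [
    ([1, 1, 2, 2, 1, 1, 0], 0, 0, 2, 1/2), ([0, 0, 0, 1, 0, 0, 0], 0, 0, 3, 1/2),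
    ([0, 1, 1, 2, 1, 1, 0], 0, 0, 4, 1/2), ([1, 0, 1, 1, 0, 0, 0], 0, 0, 5, 1/2),
    ([0, 0, 1, 1, 0, 0, 0], 0, 0, 6, 1/2), ([1, 1, 1, 2, 1, 1, 0], 0, 0, 7, - 1/2),
    ([0, 0, 0, - 1, 0, 0, 0], 0, 1, 2, 1/2), ([- 1, - 1, - 2, - 2, - 1, - 1, 0], 0, 1, 3, 1/2),
    ([- 1, 0, - 1, - 1, 0, 0, 0], 0, 1, 4, 1/2), ([0, - 1, - 1, - 2, - 1, - 1, 0], 0, 1, 5, 1/2),
    ([- 1, - 1, - 1, - 2, - 1, - 1, 0], 0, 1, 6, - 1/2), ([0, 0, - 1, - 1, 0, 0, 0], 0, 1, 7, 1/2),
    ([0, 1, 1, 1, 1, 1, 0], 0, 2, 4, 1/2), ([1, 0, 1, 0, 0, 0, 0], 0, 2, 5, 1/2),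
    ([0, 0, 1, 0, 0, 0, 0], 0, 2, 6, 1/2), ([1, 1, 1, 1, 1, 1, 0], 0, 2, 7, - 1/2),
    ([- 1, 0, - 1, 0, 0, 0, 0], 0, 3, 4, 1/2), ([0, - 1, - 1, - 1, - 1, - 1, 0], 0, 3, 5, 1/2),
    ([- 1, - 1, - 1, - 1, - 1, - 1, 0], 0, 3, 6, - 1/2), ([0, 0, - 1, 0, 0, 0, 0], 0, 3, 7, 1/2),
    ([- 1, 0, 0, 0, 0, 0, 0], 0, 4, 6, - 1/2), ([0, 1, 0, 1, 1, 1, 0], 0, 4, 7, 1/2),
    ([0, - 1, 0, - 1, - 1, - 1, 0], 0, 5, 6, 1/2), ([1, 0, 0, 0, 0, 0, 0], 0, 5, 7, - 1/2)]"

definition e7_sp1_table :: "(int list \<times> nat \<times> 8 \<times> 8 \<times> real) list" where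
  "e7_sp1_table = [
    ([0, 0, 0, 0, 0, - 1, - 1], 1, 0, 2, - 1/2), ([1, 1, 2, 3, 3, 2, 1], 1, 0, 3, 1/2),
    ([- 1, - 1, - 2, - 3, - 3, - 2, - 1], 1, 1, 2, 1/2), ([0, 0, 0, 0, 0, 1, 1], 1, 1, 3, - 1/2),
    ([- 1, - 2, - 2, - 3, - 2, - 1, - 1], 1, 4, 7, - 1/2), ([1, 2, 2, 3, 2, 1, 1], 1, 5, 6, - 1/2)]"

definition e7_table_1 :: "(int list \<times> nat \<times> 8 \<times> 8 \<times> real) list" where
  "e7_table_1 = [
    ([1, 1, 2, 3, 2, 1, 0], 2, 0, 0, 1), ([0, 0, 0, 0, - 1, 0, 0], 2, 0, 1, 1),
    ([0, 0, 0, 0, - 1, - 1, - 1], 2, 0, 2, 1), ([1, 1, 2, 3, 2, 2, 1], 2, 0, 3, - 1),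
    ([0, 0, 0, 0, 1, 0, 0], 2, 1, 0, 1), ([- 1, - 1, - 2, - 3, - 2, - 1, 0], 2, 1, 1, 1),
    ([- 1, - 1, - 2, - 3, - 2, - 2, - 1], 2, 1, 2, - 1), ([0, 0, 0, 0, 1, 1, 1], 2, 1, 3, 1),
    ([1, 1, 2, 2, 2, 1, 0], 2, 2, 0, 1), ([0, 0, 0, - 1, - 1, 0, 0], 2, 2, 1, 1),
    ([0, 0, 0, - 1, - 1, - 1, - 1], 2, 2, 2, 1), ([1, 1, 2, 2, 2, 2, 1], 2, 2, 3, - 1),
    ([0, 0, 0, 1, 1, 0, 0], 2, 3, 0, 1), ([- 1, - 1, - 2, - 2, - 2, - 1, 0], 2, 3, 1, 1),
    ([- 1, - 1, - 2, - 2, - 2, - 2, - 1], 2, 3, 2, - 1), ([0, 0, 0, 1, 1, 1, 1], 2, 3, 3, 1),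
    ([0, 1, 1, 2, 2, 1, 0], 2, 4, 0, 1), ([- 1, 0, - 1, - 1, - 1, 0, 0], 2, 4, 1, 1),
    ([- 1, 0, - 1, - 1, - 1, - 1, - 1], 2, 4, 2, 1), ([0, 1, 1, 2, 2, 2, 1], 2, 4, 3, - 1),
    ([1, 0, 1, 1, 1, 0, 0], 2, 5, 0, 1), ([0, - 1, - 1, - 2, - 2, - 1, 0], 2, 5, 1, 1),
    ([0, - 1, - 1, - 2, - 2, - 2, - 1], 2, 5, 2, - 1), ([1, 0, 1, 1, 1, 1, 1], 2, 5, 3, 1),
    ([0, 0, 1, 1, 1, 0, 0], 2, 6, 0, 1), ([- 1, - 1, - 1, - 2, - 2, - 1, 0], 2, 6, 1, - 1),
    ([- 1, - 1, - 1, - 2, - 2, - 2, - 1], 2, 6, 2, 1), ([0, 0, 1, 1, 1, 1, 1], 2, 6, 3, 1),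
    ([1, 1, 1, 2, 2, 1, 0], 2, 7, 0, - 1), ([0, 0, - 1, - 1, - 1, 0, 0], 2, 7, 1, 1),
    ([0, 0, - 1, - 1, - 1, - 1, - 1], 2, 7, 2, 1), ([1, 1, 1, 2, 2, 2, 1], 2, 7, 3, 1)]"

definition e7_table_2 :: "(int list \<times> nat \<times> 8 \<times> 8 \<times> real) list" where
  "e7_table_2 = [
    ([- 1, - 1, - 2, - 3, - 2, - 1, - 1], 3, 0, 0, - 1), ([1, 2, 2, 3, 3, 2, 1], 3, 0, 1, 1),
    ([0, 1, 0, 0, 0, 0, 0], 3, 0, 2, 1), ([0, 0, 0, 0, 1, 1, 0], 3, 0, 3, - 1),
    ([- 1, - 2, - 2, - 3, - 3, - 2, - 1], 3, 1, 0, 1), ([1, 1, 2, 3, 2, 1, 1], 3, 1, 1, - 1),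
    ([0, 0, 0, 0, - 1, - 1, 0], 3, 1, 2, - 1), ([0, - 1, 0, 0, 0, 0, 0], 3, 1, 3, 1),
    ([- 1, - 2, - 2, - 4, - 3, - 2, - 1], 3, 2, 0, 1), ([1, 1, 2, 2, 2, 1, 1], 3, 2, 1, 1),
    ([0, 0, 0, - 1, - 1, - 1, 0], 3, 2, 2, 1), ([0, - 1, 0, - 1, 0, 0, 0], 3, 2, 3, 1),
    ([- 1, - 1, - 2, - 2, - 2, - 1, - 1], 3, 3, 0, 1), ([1, 2, 2, 4, 3, 2, 1], 3, 3, 1, 1),
    ([0, 1, 0, 1, 0, 0, 0], 3, 3, 2, 1), ([0, 0, 0, 1, 1, 1, 0], 3, 3, 3, 1),
    ([- 2, - 2, - 3, - 4, - 3, - 2, - 1], 3, 4, 0, 1), ([0, 1, 1, 2, 2, 1, 1], 3, 4, 1, 1),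
    ([- 1, 0, - 1, - 1, - 1, - 1, 0], 3, 4, 2, 1), ([- 1, - 1, - 1, - 1, 0, 0, 0], 3, 4, 3, 1),
    ([0, - 1, - 1, - 2, - 2, - 1, - 1], 3, 5, 0, 1), ([2, 2, 3, 4, 3, 2, 1], 3, 5, 1, 1),
    ([1, 1, 1, 1, 0, 0, 0], 3, 5, 2, 1), ([1, 0, 1, 1, 1, 1, 0], 3, 5, 3, 1),
    ([- 1, - 1, - 1, - 2, - 2, - 1, - 1], 3, 6, 0, - 1), ([1, 2, 3, 4, 3, 2, 1], 3, 6, 1, - 1),
    ([0, 1, 1, 1, 0, 0, 0], 3, 6, 2, 1), ([0, 0, 1, 1, 1, 1, 0], 3, 6, 3, 1),
    ([- 1, - 2, - 3, - 4, - 3, - 2, - 1], 3, 7, 0, - 1), ([1, 1, 1, 2, 2, 1, 1], 3, 7, 1, - 1),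
    ([0, 0, - 1, - 1, - 1, - 1, 0], 3, 7, 2, 1), ([0, - 1, - 1, - 1, 0, 0, 0], 3, 7, 3, 1)]"

definition e7_table_3 :: "(int list \<times> nat \<times> 8 \<times> 8 \<times> real) list" where
  "e7_table_3 = [
    ([0, 0, 0, 0, 0, 0, 1], 4, 0, 0, - 1), ([- 1, - 2, - 2, - 3, - 2, - 2, - 1], 4, 0, 1, - 1),
    ([0, 0, 0, 0, 0, - 1, 0], 4, 0, 2, 1), ([- 1, - 2, - 2, - 3, - 2, - 1, 0], 4, 0, 3, 1),
    ([1, 2, 2, 3, 2, 2, 1], 4, 1, 0, - 1), ([0, 0, 0, 0, 0, 0, - 1], 4, 1, 1, - 1),
    ([1, 2, 2, 3, 2, 1, 0], 4, 1, 2, 1), ([0, 0, 0, 0, 0, 1, 0], 4, 1, 3, 1),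
    ([1, 1, 2, 2, 1, 1, 1], 4, 2, 0, 1), ([0, - 1, 0, - 1, - 1, - 1, - 1], 4, 2, 1, 1),
    ([1, 1, 2, 2, 1, 0, 0], 4, 2, 2, 1), ([0, - 1, 0, - 1, - 1, 0, 0], 4, 2, 3, 1),
    ([0, 1, 0, 1, 1, 1, 1], 4, 3, 0, 1), ([- 1, - 1, - 2, - 2, - 1, - 1, - 1], 4, 3, 1, 1),
    ([0, 1, 0, 1, 1, 0, 0], 4, 3, 2, 1), ([- 1, - 1, - 2, - 2, - 1, 0, 0], 4, 3, 3, 1),
    ([0, 1, 1, 2, 1, 1, 1], 4, 4, 0, 1), ([- 1, - 1, - 1, - 1, - 1, - 1, - 1], 4, 4, 1, 1),
    ([0, 1, 1, 2, 1, 0, 0], 4, 4, 2, 1), ([- 1, - 1, - 1, - 1, - 1, 0, 0], 4, 4, 3, 1),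
    ([1, 1, 1, 1, 1, 1, 1], 4, 5, 0, 1), ([0, - 1, - 1, - 2, - 1, - 1, - 1], 4, 5, 1, 1),
    ([1, 1, 1, 1, 1, 0, 0], 4, 5, 2, 1), ([0, - 1, - 1, - 2, - 1, 0, 0], 4, 5, 3, 1),
    ([0, 1, 1, 1, 1, 1, 1], 4, 6, 0, 1), ([- 1, - 1, - 1, - 2, - 1, - 1, - 1], 4, 6, 1, - 1),
    ([0, 1, 1, 1, 1, 0, 0], 4, 6, 2, 1), ([- 1, - 1, - 1, - 2, - 1, 0, 0], 4, 6, 3, - 1),
    ([1, 1, 1, 2, 1, 1, 1], 4, 7, 0, - 1), ([0, - 1, - 1, - 1, - 1, - 1, - 1], 4, 7, 1, 1),
    ([1, 1, 1, 2, 1, 0, 0], 4, 7, 2, - 1), ([0, - 1, - 1, - 1, - 1, 0, 0], 4, 7, 3, 1)]"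

definition e7_table :: "(int list \<times> nat \<times> 8 \<times> 8 \<times> real) list" where
  "e7_table = e7_so8_table @ e7_sp1_table @ e7_table_1 @ e7_table_2 @ e7_table_3"

lemmas e7_table_blocks = e7_so8_table_def e7_sp1_table_def e7_table_1_def e7_table_2_def e7_table_3_def

lemmas e7_table_eq = e7_table_def[unfolded e7_table_blocks append.simps]

definition e7_roots :: "int list list" where
  "e7_roots = map fst e7_table"

lemmas e7_roots_eq = e7_roots_def[unfolded e7_table_eq list.map fst_conv]

lemma length_e7_roots: "l \<in> set e7_roots \<Longrightarrow> length l = 7"
  unfolding e7_roots_eq list.set by (elim insertE emptyE) simp_all

lemma distinct_e7_roots: "distinct e7_roots"
  unfolding e7_roots_eq by code_simp

section \<open>Enumeration of the lattice vectors of norm 2\<close>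

fun square_sum_lists :: "nat \<Rightarrow> int \<Rightarrow> int list list" where
  "square_sum_lists 0 m = (if m = 0 then [[]] else [])"
| "square_sum_lists (Suc k) m = concat (map (\<lambda>d.
     if d * d \<le> m then map ((#) d) (square_sum_lists k (m - d * d)) else []) [-2, -1, 0, 1, 2])"

text \<open>The bound 4 forces every entry into the range -2, ..., 2 that the enumeration
  tries.\<close>

lemma square_sum_lists:
  "(\<Sum>d\<leftarrow>l. d * d) \<le> 4 \<Longrightarrow> l \<in> set (square_sum_lists (length l) (\<Sum>d\<leftarrow>l. d * d))"
proof (induction l)
  case (Cons d l)
  have nonneg: "0 \<le> (\<Sum>d\<leftarrow>l. d * d)"
    by (rule sum_list_nonneg) auto
  then have "d * d \<le> 2 * 2" using Cons.prems by simp
  then have "\<bar>d\<bar> \<le> 2" using abs_le_square_iff[of d 2] by (simp add: power2_eq_square)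
  then have "d \<in> {-2, -1, 0, 1, 2}" by auto
  moreover have "l \<in> set (square_sum_lists (length l) (\<Sum>d\<leftarrow>l. d * d))"
  proof (rule Cons.IH)
    have "d * d + (\<Sum>d\<leftarrow>l. d * d) \<le> 4" using Cons.prems by simp
    then show "(\<Sum>d\<leftarrow>l. d * d) \<le> 4" using zero_le_square[of d] by linarith
  qed
  ultimately show ?case using nonneg by auto
qed simp

text \<open>Recovers twice the simple root coordinates from the inner products $n_i$; a list with an odd entry
  does not come from the root lattice.\<close>

fun orthogonal_to_doubled :: "int list \<Rightarrow> int list" where
  "orthogonal_to_doubled [n0, n1, n2, n3, n4, n5, n6] = [n0 - n2 + n5 - n6,
     n0 + n3 + n5 - 2 * n6,
     2 * n0 + 2 * n5 - 2 * n6,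
     2 * n0 + n1 + n3 + 3 * n5 - 3 * n6,
     n0 + n3 + 3 * n5 - 2 * n6,
     n0 + n3 - n4 + 2 * n5 - n6,
     - n4 + n5 - n6]"
| "orthogonal_to_doubled _ = []"

text \<open>There are 574 candidates: 14 with a single entry 2 or -2, and 560 with four entries 1 or
  -1. Parity depends only on the support of the candidate; 7 of the 35 supports of size four
  survive, which leaves 14 + 7 * 16 = 126 roots.\<close>

lemma roots_enumeration:
  "list_all (\<lambda>l. let m = orthogonal_to_doubled l in
     list_ex odd m \<or> map (\<lambda>z. z div 2) m \<in> set e7_roots) (square_sum_lists 7 4)"
  unfolding e7_roots_eq by code_simp

lemma list_all_eval: "list_all P [] = True" "list_all P (x # xs) = (P x \<and> list_all P xs)"
  by simp_all

lemma roots_norm: "list_all (\<lambda>l. lattice_form cartan_E7 (lattice_vec l) (lattice_vec l) = 2) e7_roots"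
  unfolding e7_roots_eq list_all_eval lattice_form_E7 lattice_vec_nth by simp

lemma roots_E7: "roots cartan_E7 = lattice_vec ` set e7_roots"
proof (intro equalityI subsetI)
  fix x assume "x \<in> roots cartan_E7"
  then have norm: "lattice_form cartan_E7 x x = 2" by (simp add: roots_def)

  define n where "n = [x$2 - x$4 + x$5 - x$6,
    - x$1 - x$2 + 2 * x$3 - x$4,
    - 2 * x$0 + x$2,
    x$1 - x$2 + x$5 - x$6,
    x$4 - x$5 - x$6,
    - x$1 + x$4,
    - x$1 + x$5 - x$6]"
  have "(\<Sum>d\<leftarrow>n. d * d) = 2 * lattice_form cartan_E7 x x"
    unfolding n_def lattice_form_E7 by (simp add: algebra_simps)
  then have sq: "(\<Sum>d\<leftarrow>n. d * d) = 4" using norm by simp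
  have "length n = 7" by (simp add: n_def)
  then have "n \<in> set (square_sum_lists 7 4)"
    using square_sum_lists[of n, unfolded sq] by (simp only: order_refl simp_thms)
  then have "list_ex odd (orthogonal_to_doubled n)
      \<or> map (\<lambda>z. z div 2) (orthogonal_to_doubled n) \<in> set e7_roots"
    using roots_enumeration by (simp add: list_all_iff Let_def)
  moreover have "orthogonal_to_doubled n = map (\<lambda>z. 2 * z) [x$0, x$1, x$2, x$3, x$4, x$5, x$6]"
    unfolding n_def orthogonal_to_doubled.simps list.map list.inject by (simp add: algebra_simps)
  ultimately have "[x$0, x$1, x$2, x$3, x$4, x$5, x$6] \<in> set e7_roots" by simp
  then show "x \<in> lattice_vec ` set e7_roots"
    using lattice_vec_eta[of x] by blast
next
  fix x assume "x \<in> lattice_vec ` set e7_roots"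
  then show "x \<in> roots cartan_E7"
    using roots_norm by (auto simp: roots_def list_all_iff)
qed

lemma sum_roots: "(\<Sum>a\<in>roots cartan_E7. F a) = (\<Sum>l\<leftarrow>e7_roots. F (lattice_vec l))"
proof -
  have "inj_on lattice_vec (set e7_roots)"
    using inj_lattice_vec by (rule inj_on_subset) (auto dest: length_e7_roots)
  then have "(\<Sum>a\<in>roots cartan_E7. F a) = (\<Sum>l\<in>set e7_roots. F (lattice_vec l))"
    unfolding roots_E7 by (simp add: sum.reindex)
  also have "\<dots> = (\<Sum>l\<leftarrow>e7_roots. F (lattice_vec l))"
    by (rule sum.distinct_set_conv_list[OF distinct_e7_roots])
  finally show ?thesis .
qed

lemma finite_roots_E7: "finite (roots cartan_E7)"
  unfolding roots_E7 by simp

lemma lattice_form_diff: "lattice_form A (x - y) (x - y) =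
   lattice_form A x x - lattice_form A x y - lattice_form A y x + lattice_form A y y"
  unfolding lattice_form_def by (simp add: algebra_simps sum.distrib sum_subtractf)

text \<open>For roots c and a, the norm of c - a is 4 - 2(c,a), hence c - a is a root iff (c,a) = 1.
  This turns the index set of the Chevalley bracket into a filter on an explicit list.\<close>

lemma sum_root_decompositions:
  assumes "c \<in> roots cartan_E7"
  shows "(\<Sum>a | a \<in> roots cartan_E7 \<and> c - a \<in> roots cartan_E7. F a) =
    (\<Sum>l\<leftarrow>filter (\<lambda>l. lattice_form cartan_E7 c (lattice_vec l) = 1) e7_roots. F (lattice_vec l))"
proof -
  have sym: "lattice_form cartan_E7 x y = lattice_form cartan_E7 y x" for x y
    unfolding lattice_form_E7 by (simp add: algebra_simps)
  have "{a. a \<in> roots cartan_E7 \<and> c - a \<in> roots cartan_E7}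
      = {a \<in> roots cartan_E7. lattice_form cartan_E7 c a = 1}"
  proof (rule Collect_cong)
    fix a
    show "(a \<in> roots cartan_E7 \<and> c - a \<in> roots cartan_E7)
        \<longleftrightarrow> (a \<in> roots cartan_E7 \<and> lattice_form cartan_E7 c a = 1)"
      using assms sym[of a c] lattice_form_diff[of cartan_E7 c a] unfolding roots_def mem_Collect_eq
      by linarith
  qed
  then have "(\<Sum>a | a \<in> roots cartan_E7 \<and> c - a \<in> roots cartan_E7. F a) =
      (\<Sum>a\<in>roots cartan_E7. if lattice_form cartan_E7 c a = 1 then F a else 0)"
    by (simp add: sum.inter_filter[symmetric] finite_roots_E7)
  then show ?thesis
    unfolding sum_roots by (simp add: sum_list_map_filter')
qed

section \<open>The subspace e7 in weight coordinates\<close>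

text \<open>Weight vectors 4 to 7 involve only $e_4, ..., e_7$, and \<open>bar\<close> preserves
  this range of indices. Consequently the quaternionic condition looks the same in both
  bases.\<close>

lemma wt_columns_zero_iff:
  "(\<forall>i. \<forall>j\<in>{4,5,6,7}. X $ i $ j = 0) \<longleftrightarrow> (\<forall>p. \<forall>q\<in>{4,5,6,7}. wt X p q = 0)"
proof
  assume "\<forall>i. \<forall>j\<in>{4,5,6,7}. X $ i $ j = 0"
  then show "\<forall>p. \<forall>q\<in>{4,5,6,7}. wt X p q = 0"
    by (simp add: wt_alt sum_weight)
next
  assume w: "\<forall>p. \<forall>q\<in>{4,5,6,7}. wt X p q = 0"
  have z: "\<forall>j\<in>{4,5,6,7}. \<forall>q\<in>{0,1,2,3}. weight (bar q) j = 0"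
    by (simp add: weight_def neq_8)
  have "complex_of_real (X $ i $ j) = 0" if "j \<in> {4,5,6,7}" for i j
  proof -
    have z0: "weight (bar p) i * weight (bar q) j * wt X p q = 0" for p q
    proof (cases "q \<in> {0,1,2,3}")
      case True
      then have "weight (bar q) j = 0" using z that by blast
      then show ?thesis by simp
    next
      case False
      then have "q \<in> {4,5,6,7}" using exhaust_8[of q] by blast
      then have "wt X p q = 0" using w by blast
      then show ?thesis by simp
    qed
    show ?thesis unfolding wt_inverse z0 by simp
  qed
  then show "\<forall>i. \<forall>j\<in>{4,5,6,7}. X $ i $ j = 0" by simp
qed

lemma quaternions_nth: "y \<in> quaternions \<Longrightarrow> \<forall>j\<in>{4,5,6,7}. y $ j = 0"
proof -
  have "quaternions \<subseteq> {y. \<forall>j\<in>{4,5,6,7}. y $ j = 0}"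
    unfolding quaternions_def
    by (rule span_minimal) (auto simp: subspace_def oct_e_nth)
  then show "y \<in> quaternions \<Longrightarrow> \<forall>j\<in>{4,5,6,7}. y $ j = 0" by blast
qed

lemma oct_tensor_quat_iff_nth:
  "X \<in> oct_tensor_quat \<longleftrightarrow> (\<forall>i. \<forall>j\<in>{4,5,6,7}. X $ i $ j = 0)"
proof
  have "oct_tensor_quat \<subseteq> {X. \<forall>i. \<forall>j\<in>{4,5,6,7}. X $ i $ j = 0}"
    unfolding oct_tensor_quat_def
  proof (rule span_minimal)
    show "{outer x y |x y. y \<in> quaternions} \<subseteq> {X. \<forall>i. \<forall>j\<in>{4,5,6,7}. X $ i $ j = 0}"
      using quaternions_nth by (auto simp: outer_def)
    show "subspace {X :: mat8. \<forall>i. \<forall>j\<in>{4,5,6,7}. X $ i $ j = 0}"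
      by (auto simp: subspace_def)
  qed
  then show "X \<in> oct_tensor_quat \<Longrightarrow> \<forall>i. \<forall>j\<in>{4,5,6,7}. X $ i $ j = 0" by blast
next
  assume z: "\<forall>i. \<forall>j\<in>{4,5,6,7}. X $ i $ j = 0"
  have "X = (\<Sum>j\<in>{0,1,2,3}. outer (column j X) (oct_e j))"
  proof -
    have "\<forall>m n. X $ m $ n = (\<Sum>j\<in>{0,1,2,3}. outer (column j X) (oct_e j)) $ m $ n"
    proof (rule allI)
      fix m
      show "\<forall>n. X $ m $ n = (\<Sum>j\<in>{0,1,2,3}. outer (column j X) (oct_e j)) $ m $ n"
        unfolding forall_8 using z by (simp add: outer_def column_def oct_e_nth neq_8)
    qed
    then show ?thesis by (simp add: vec_eq_iff)
  qed
  also have "\<dots> \<in> oct_tensor_quat"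
    unfolding oct_tensor_quat_def
  proof (intro span_sum span_base)
    fix j :: 8 assume "j \<in> {0,1,2,3}"
    then have "oct_e j \<in> quaternions"
      unfolding quaternions_def by (intro span_base) auto
    then show "outer (column j X) (oct_e j) \<in> {outer x y |x y. y \<in> quaternions}" by blast
  qed
  finally show "X \<in> oct_tensor_quat" .
qed

lemma oct_tensor_quat_iff: "X \<in> oct_tensor_quat \<longleftrightarrow> (\<forall>p. \<forall>q\<in>{4,5,6,7}. wt X p q = 0)"
  unfolding oct_tensor_quat_iff_nth wt_columns_zero_iff ..

lemma so4_iff: "A \<in> so4 \<longleftrightarrow> A \<in> so8 \<and> (\<forall>p. \<forall>q\<in>{4,5,6,7}. wt A p q = 0)"
proof -
  have i: "k \<notin> {0,1,2,3} \<longleftrightarrow> k \<in> {4,5,6,7}" for k :: 8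
    using exhaust_8[of k] by (elim disjE) (simp_all add: neq_8)
  have "A \<in> so4 \<longleftrightarrow> A \<in> so8 \<and> (\<forall>i. \<forall>j\<in>{4,5,6,7}. A $ i $ j = 0)"
  proof (cases "A \<in> so8")
    case True
    have "A $ j $ i = 0 \<longleftrightarrow> A $ i $ j = 0" for i j
      using so8_nth[OF True, of i j] by simp
    then show ?thesis unfolding so4_def mem_Collect_eq i using True by blast
  qed (simp add: so4_def)
  then show ?thesis unfolding wt_columns_zero_iff .
qed

lemma transpose_plus: "transpose (X + Y) = transpose X + transpose Y"
  by (simp add: transpose_def vec_eq_iff)

lemma transpose_minus: "transpose (X - Y) = transpose X - transpose Y"
  by (simp add: transpose_def vec_eq_iff)

lemma so8_closed:
  "A \<in> so8 \<Longrightarrow> B \<in> so8 \<Longrightarrow> A + B \<in> so8"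
  "A \<in> so8 \<Longrightarrow> B \<in> so8 \<Longrightarrow> A - B \<in> so8"
  "A \<in> so8 \<Longrightarrow> c *\<^sub>R A \<in> so8"
  "0 \<in> so8"
  by (simp_all add: so8_def transpose_plus transpose_minus transpose_scalar)
      (simp add: transpose_def vec_eq_iff)

lemma so8_commutator [simp]: "A \<in> so8 \<Longrightarrow> B \<in> so8 \<Longrightarrow> commutator A B \<in> so8"
proof -
  have "(- X) ** (- Y) = X ** Y" for X Y :: mat8
    by (simp add: matrix_matrix_mult_def vec_eq_iff)
  then show "A \<in> so8 \<Longrightarrow> B \<in> so8 \<Longrightarrow> commutator A B \<in> so8"
    by (simp add: so8_def commutator_def matrix_transpose_mul transpose_minus)
qed

lemma so8_skew_products [simp]:
  "X ** transpose Y - Y ** transpose X \<in> so8"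
  "transpose X ** Y - transpose Y ** X \<in> so8"
  by (simp_all add: so8_def matrix_transpose_mul transpose_minus)

lemma triality_zero [simp]: "triality 0 = 0"
  by (simp add: triality_def)

text \<open>The upper left block is $\mathfrak{so}(4)$; the last three conditions single out one of the two
  $\mathfrak{sp}(1)$ factors in the lower right block.\<close>

definition sp1_cubed_wt :: "mat8 set" where
  "sp1_cubed_wt = {B \<in> so8. (\<forall>p\<in>{0,1,2,3}. \<forall>q\<in>{4,5,6,7}. wt B p q = 0) \<and>
     wt B 4 6 = 0 \<and> wt B 5 7 = 0 \<and> wt B 6 7 = - wt B 4 5}"

lemma sp1_cubed_wt_triality: "B \<in> sp1_cubed_wt \<Longrightarrow> triality B \<in> sp1_cubed_wt"
  by (simp add: sp1_cubed_wt_def wt_triality field_simps)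

lemma so4_subset_sp1_cubed_wt: "so4 \<subseteq> sp1_cubed_wt"
  by (auto simp: so4_iff sp1_cubed_wt_def wt_so8)

lemma sp1_cubed_wt_add: "A \<in> sp1_cubed_wt \<Longrightarrow> B \<in> sp1_cubed_wt \<Longrightarrow> A + B \<in> sp1_cubed_wt"
  by (simp add: sp1_cubed_wt_def so8_closed)

text \<open>One inclusion holds because \<open>sp1_cubed_wt\<close> contains \<open>so4\<close>, is
  stable under triality and is closed under addition. For the other, an element of
  \<open>so4\<close> is sought whose triality image accounts for the lower right block.\<close>

lemma sp1_cubed_eq: "sp1_cubed = sp1_cubed_wt"
proof
  show "sp1_cubed \<subseteq> sp1_cubed_wt"
    unfolding sp1_cubed_def using so4_subset_sp1_cubed_wt
    by (auto intro!: sp1_cubed_wt_add sp1_cubed_wt_triality)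
  show "sp1_cubed_wt \<subseteq> sp1_cubed"
  proof
    fix B assume B: "B \<in> sp1_cubed_wt"
    then have Bso: "B \<in> so8" by (simp add: sp1_cubed_wt_def)
    \<comment> \<open>Read off from \<open>wt_triality\<close> backwards: the triality image of this
      matrix has the coordinates of \<open>B\<close> at (4,5), (4,7), (5,6) and (6,7), the last one
      thanks to the condition that couples (6,7) with (4,5). The difference then lies in
      \<open>so4\<close>.\<close>
    define W :: "8 \<Rightarrow> 8 \<Rightarrow> complex" where "W p q =
      (if p = 0 \<and> q = 1 then - 2 * wt B 4 5 else if p = 1 \<and> q = 0 then 2 * wt B 4 5
       else if p = 1 \<and> q = 3 then - wt B 4 7 else if p = 3 \<and> q = 1 then wt B 4 7
       else if p = 0 \<and> q = 2 then - wt B 5 6 else if p = 2 \<and> q = 0 then wt B 5 6 else 0)" for p q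
    have "\<forall>p q. W (bar p) (bar q) = cnj (W p q)"
      unfolding forall_8 W_def by (simp add: neq_8 wt_bar[symmetric] wt_so8[OF Bso])
    then have wQ: "wt (unwt W) p q = W p q" for p q
      by (intro wt_unwt) blast
    have "\<forall>p q. wt (unwt W) q p = - wt (unwt W) p q"
      unfolding wQ forall_8 by (simp add: W_def neq_8)
    then have Qso: "unwt W \<in> so8" unfolding so8_iff_wt .
    have "\<forall>p. \<forall>q\<in>{4,5,6,7}. wt (unwt W) p q = 0"
      unfolding wQ forall_8 by (simp add: W_def neq_8)
    then have Q4: "unwt W \<in> so4" using Qso by (simp add: so4_iff)
    have "\<forall>p. \<forall>q\<in>{4,5,6,7}. wt (B - triality (unwt W)) p q = 0"
      unfolding forall_8 using B
      by (simp add: sp1_cubed_wt_def wt_triality[OF Qso] wt_so8[OF triality_so8] wt_so8[OF Bso] wQ)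
         (simp add: W_def neq_8)
    then have P4: "B - triality (unwt W) \<in> so4"
      using Bso by (simp add: so4_iff so8_closed)
    have "0 \<in> so4" by (simp add: so4_iff so8_closed)
    then have "B = (B - triality (unwt W)) + triality (unwt W) + triality (triality 0) \<and> 0 \<in> so4"
      by simp
    then show "B \<in> sp1_cubed"
      unfolding sp1_cubed_def using P4 Q4 by blast
  qed
qed

lemmas sp1_cubed_iff = sp1_cubed_eq[THEN eqset_imp_iff, unfolded sp1_cubed_wt_def mem_Collect_eq]

lemma wt_tensor_zero:
  assumes "X \<in> oct_tensor_quat"
  shows "wt X p 4 = 0" "wt X p 5 = 0" "wt X p 6 = 0" "wt X p 7 = 0"
  using assms by (simp_all add: oct_tensor_quat_iff)

lemma wt_sp1_zero:
  assumes "X \<in> sp1_cubed"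
  shows "wt X 0 4 = 0" "wt X 0 5 = 0" "wt X 0 6 = 0" "wt X 0 7 = 0"
    "wt X 1 4 = 0" "wt X 1 5 = 0" "wt X 1 6 = 0" "wt X 1 7 = 0"
    "wt X 2 4 = 0" "wt X 2 5 = 0" "wt X 2 6 = 0" "wt X 2 7 = 0"
    "wt X 3 4 = 0" "wt X 3 5 = 0" "wt X 3 6 = 0" "wt X 3 7 = 0"
    "wt X 4 6 = 0" "wt X 5 7 = 0" "wt X 6 7 = - wt X 4 5"
  using assms by (simp_all add: sp1_cubed_iff)

section \<open>The bracket in root coordinates\<close>

definition e7_comp :: "nat \<Rightarrow> e8 \<Rightarrow> mat8" where
  "e7_comp c X = (if c = 0 then fst (fst X) else if c = 1 then snd (fst X) else if c = 2 then fst (snd X)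
     else if c = 3 then fst (snd (snd X)) else snd (snd (snd X)))"

lemma e7_comp_simps:
  "e7_comp 0 X = fst (fst X)" "e7_comp 1 X = snd (fst X)" "e7_comp 2 X = fst (snd X)"
  "e7_comp 3 X = fst (snd (snd X))" "e7_comp 4 X = snd (snd (snd X))"
  by (simp_all add: e7_comp_def)

text \<open>As a sum over the table this is visibly linear in \<open>X\<close> and zero off the
  roots; on a root a single summand survives, because the roots in the table are distinct.\<close>

definition e7_coord :: "e8 \<Rightarrow> int ^ 7 \<Rightarrow> complex" where
  "e7_coord X a = (\<Sum>(l, c, p, q, s)\<leftarrow>e7_table.
     if lattice_vec l = a then of_real s * wt (e7_comp c X) p q else 0)"

text \<open>The inverse of the linear map in \<open>e7_cartan_diag\<close> below.\<close>

definition e7_cartan :: "e8 \<Rightarrow> complex ^ 7" where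
  "e7_cartan X = (let d0 = wt (e7_comp 0 X) 0 1;
     d1 = wt (e7_comp 0 X) 2 3;
     d2 = wt (e7_comp 0 X) 4 5;
     d3 = wt (e7_comp 0 X) 6 7;
     d4 = wt (e7_comp 1 X) 0 1;
     d5 = wt (e7_comp 1 X) 2 3;
     d6 = wt (e7_comp 1 X) 4 5 in
     (\<chi> i. (if i = 0 then d0 + d1 - d2 - d3 + d4 - d5 - 2 * d6
       else if i = 1 then d0 + d1 + d2 - d3 + d4 - d5 - 4 * d6
       else if i = 2 then 2 * d0 + 2 * d1 + 2 * d4 - 2 * d5 - 4 * d6
       else if i = 3 then 3 * d0 + d1 + d2 - d3 + 3 * d4 - 3 * d5 - 6 * d6
       else if i = 4 then d0 + d1 + d2 - d3 + 3 * d4 - 3 * d5 - 4 * d6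
       else if i = 5 then d0 + d1 + d2 - d3 + d4 - 3 * d5 - 2 * d6
       else - 2 * d5 - 2 * d6) / 4))"

lemma e7_cartan_nth:
  "e7_cartan X $ 0 = (wt (e7_comp 0 X) 0 1 + wt (e7_comp 0 X) 2 3 - wt (e7_comp 0 X) 4 5 - wt
      (e7_comp 0 X) 6 7 + wt (e7_comp 1 X) 0 1 - wt (e7_comp 1 X) 2 3 - 2 * wt (e7_comp 1 X) 4 5) / 4"
  "e7_cartan X $ 1 = (wt (e7_comp 0 X) 0 1 + wt (e7_comp 0 X) 2 3 + wt (e7_comp 0 X) 4 5 - wt
      (e7_comp 0 X) 6 7 + wt (e7_comp 1 X) 0 1 - wt (e7_comp 1 X) 2 3 - 4 * wt (e7_comp 1 X) 4 5) / 4"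
  "e7_cartan X $ 2 = (2 * wt (e7_comp 0 X) 0 1 + 2 * wt (e7_comp 0 X) 2 3 + 2 * wt (e7_comp 1 X) 0
      1 - 2 * wt (e7_comp 1 X) 2 3 - 4 * wt (e7_comp 1 X) 4 5) / 4"
  "e7_cartan X $ 3 = (3 * wt (e7_comp 0 X) 0 1 + wt (e7_comp 0 X) 2 3 + wt (e7_comp 0 X) 4 5 - wt
      (e7_comp 0 X) 6 7 + 3 * wt (e7_comp 1 X) 0 1 - 3 * wt (e7_comp 1 X) 2 3 - 6 * wt (e7_comp 1 X) 4
      5) / 4"
  "e7_cartan X $ 4 = (wt (e7_comp 0 X) 0 1 + wt (e7_comp 0 X) 2 3 + wt (e7_comp 0 X) 4 5 - wt
      (e7_comp 0 X) 6 7 + 3 * wt (e7_comp 1 X) 0 1 - 3 * wt (e7_comp 1 X) 2 3 - 4 * wt (e7_comp 1 X) 4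
      5) / 4"
  "e7_cartan X $ 5 = (wt (e7_comp 0 X) 0 1 + wt (e7_comp 0 X) 2 3 + wt (e7_comp 0 X) 4 5 - wt
      (e7_comp 0 X) 6 7 + wt (e7_comp 1 X) 0 1 - 3 * wt (e7_comp 1 X) 2 3 - 2 * wt (e7_comp 1 X) 4 5)
      / 4"
  "e7_cartan X $ 6 = (- 2 * wt (e7_comp 1 X) 2 3 - 2 * wt (e7_comp 1 X) 4 5) / 4"
  by (simp_all add: e7_cartan_def Let_def)

text \<open>Evaluates a sum over the table at a key: once with the root as key
  (\<open>e7_coord\<close>), once with the matrix position (\<open>e7_entry\<close>).\<close>

lemma sum_list_single:
  fixes g :: "'a \<Rightarrow> 'b::comm_monoid_add"
  assumes "distinct (map f xs)" "t \<in> set xs"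
  shows "(\<Sum>x\<leftarrow>xs. if f x = f t then g x else 0) = g t"
  using assms
proof (induction xs)
  case (Cons y xs)
  have ne: "f x \<noteq> f y" if "x \<in> set xs" for x
    using Cons.prems(1) imageI[OF that, of f] by auto
  show ?case
  proof (cases "t = y")
    case True
    then have "(\<Sum>x\<leftarrow>xs. if f x = f t then g x else 0) = (\<Sum>x\<leftarrow>xs. 0)"
      using ne by (intro arg_cong[where f = sum_list] map_cong) simp_all
    then show ?thesis using True by simp
  next
    case False
    then have "t \<in> set xs" using Cons.prems(2) by simp
    then show ?thesis using Cons ne[of t] by simp
  qed
qed simp

lemma e7_coord_table:
  "list_all (\<lambda>(l, c, p, q, s). e7_coord X (lattice_vec l) = of_real s * wt (e7_comp c X) p q) e7_table"
  unfolding list_all_iff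
proof
  fix t assume t: "t \<in> set e7_table"
  obtain l c p q s where [simp]: "t = (l, c, p, q, s)" by (cases t)
  have fst_t: "fst t' \<in> set e7_roots" if "t' \<in> set e7_table" for t'
    using that by (simp add: e7_roots_def)
  have eq: "lattice_vec (fst t') = lattice_vec l \<longleftrightarrow> fst t' = l" if "t' \<in> set e7_table" for t'
    using fst_t[OF that] fst_t[OF t] length_e7_roots
    by (intro inj_on_eq_iff[OF inj_lattice_vec]) simp_all
  have "e7_coord X (lattice_vec l) = (\<Sum>t'\<leftarrow>e7_table. if fst t' = fst t then
      (case t' of (l, c, p, q, s) \<Rightarrow> of_real s * wt (e7_comp c X) p q) else 0)"
    unfolding e7_coord_def
  proof (intro arg_cong[where f = sum_list] map_cong refl)
    fix t' assume "t' \<in> set e7_table"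
    from eq[OF this] show "(case t' of (l', c, p, q, s) \<Rightarrow>
        if lattice_vec l' = lattice_vec l then of_real s * wt (e7_comp c X) p q else 0)
      = (if fst t' = fst t then (case t' of (l, c, p, q, s) \<Rightarrow> of_real s * wt (e7_comp c X) p q) else 0)"
      by (cases t') simp
  qed
  also have "\<dots> = (case t of (l, c, p, q, s) \<Rightarrow> of_real s * wt (e7_comp c X) p q)"
    by (rule sum_list_single) (use distinct_e7_roots t in \<open>simp_all add: e7_roots_def\<close>)
  finally show "case t of (l, c, p, q, s) \<Rightarrow> e7_coord X (lattice_vec l) = of_real s * wt (e7_comp c X) p q"
    by simp
qed

lemmas e7_coord_eq = e7_coord_table[unfolded e7_table_eq list_all_eval prod.case e7_comp_simps simp_thms]

lemma cnj_index_simps: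
  "cnj_index 0 = 1" "cnj_index 1 = 0" "cnj_index 2 = 2" "cnj_index 3 = 3"
  "cnj_index 4 = 4" "cnj_index 5 = 5" "cnj_index 6 = 6" "cnj_index 7 = 7"
  by (simp_all add: cnj_index_def neq_8)

lemma cnj_sign_simps:
  "cnj_sign 0 = 1" "cnj_sign 1 = 1" "cnj_sign 2 = -1" "cnj_sign 3 = -1"
  "cnj_sign 4 = -1" "cnj_sign 5 = -1" "cnj_sign 6 = -1" "cnj_sign 7 = -1"
  by (simp_all add: cnj_sign_def neq_8)

lemmas wt_bracket = wt_mult wt_oo_cnj wt_oo_mult wt_transpose sum_8 bar_simps mult_form_simps
  cnj_index_simps cnj_sign_simps

text \<open>Unlike \<open>filter.simps\<close>, these rules do not copy the tail of the list into both branches of a conditional.\<close>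

lemma filter_conds:
  "P x \<Longrightarrow> filter P (x # xs) = x # filter P xs"
  "\<not> P x \<Longrightarrow> filter P (x # xs) = filter P xs"
  "filter P [] = []"
  by simp_all

text \<open>The Cartan matrix applied to a root. It is computed once, after which the inner products
  with all 126 roots are dot products of integer literals.\<close>

fun cartan_row :: "int list \<Rightarrow> int list" where
  "cartan_row [a, b, c, d, e, f, g] = [2 * a - c, 2 * b - d, 2 * c - a - d, 2 * d - b - c - e,
     2 * e - d - f, 2 * f - e - g, 2 * g - f]"
| "cartan_row _ = []"

fun dot7 :: "int list \<Rightarrow> int list \<Rightarrow> int" where
  "dot7 [a, b, c, d, e, f, g] [a', b', c', d', e', f', g'] =
     a * a' + b * b' + c * c' + d * d' + e * e' + f * f' + g * g'"
| "dot7 _ _ = 0"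

lemma lattice_form_dot7:
  assumes "length k = 7" "length l = 7"
  shows "lattice_form cartan_E7 (lattice_vec k) (lattice_vec l) = dot7 (cartan_row k) l"
proof -
  obtain a b c d e f g where k: "k = [a, b, c, d, e, f, g]" using assms(1) by (rule list_7)
  obtain a' b' c' d' e' f' g' where l: "l = [a', b', c', d', e', f', g']" using assms(2) by (rule list_7)
  show ?thesis
    unfolding k l lattice_form_E7 lattice_vec_nth cartan_row.simps dot7.simps
    by (simp add: algebra_simps)
qed

lemmas int_evaluation = mult_1_left mult_1_right mult_minus1 mult_minus1_right minus_minus
  diff_self diff_minus_eq_add left_minus right_minus numeral_One inc.simps add_One arith_special arith_simps rel_simps simp_thms

lemma sum_list_Cons: "sum_list [] = 0" "sum_list (x # xs) = x + sum_list xs"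
  by simp_all

text \<open>The component of \<open>chevalley_bracket\<close> at one root, with the summation in the
  evaluable form given by \<open>sum_root_decompositions\<close>.\<close>

definition bracket_coord_at :: "e8 \<Rightarrow> e8 \<Rightarrow> int list \<Rightarrow> bool" where
  "bracket_coord_at X Y l \<longleftrightarrow> e7_coord (e8_bracket X Y) (lattice_vec l) =
      root_value cartan_E7 (lattice_vec l) (e7_cartan X) * e7_coord Y (lattice_vec l)
    - root_value cartan_E7 (lattice_vec l) (e7_cartan Y) * e7_coord X (lattice_vec l)
    + (\<Sum>k\<leftarrow>filter (\<lambda>k. dot7 (cartan_row l) k = 1) e7_roots.
        root_sign cartan_E7 (lattice_vec k) (lattice_vec l - lattice_vec k)
          * e7_coord X (lattice_vec k) * e7_coord Y (lattice_vec l - lattice_vec k))"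

context
  fixes A B A' B' u v w x y z :: mat8
  assumes A: "A \<in> so8" and B: "B \<in> so8" and A': "A' \<in> sp1_cubed" and B': "B' \<in> sp1_cubed"
    and u: "u \<in> oct_tensor_quat" and v: "v \<in> oct_tensor_quat" and w: "w \<in> oct_tensor_quat"
    and x: "x \<in> oct_tensor_quat" and y: "y \<in> oct_tensor_quat" and z: "z \<in> oct_tensor_quat"
begin

lemma sp1_cubed_so8: "A' \<in> so8" "B' \<in> so8"
  using A' B' by (simp_all add: sp1_cubed_iff)

lemmas tensor_zero = wt_tensor_zero[OF u] wt_tensor_zero[OF v] wt_tensor_zero[OF w]
  wt_tensor_zero[OF x] wt_tensor_zero[OF y] wt_tensor_zero[OF z] wt_sp1_zero[OF A'] wt_sp1_zero[OF B']

lemmas so8_rules = wt_so8[OF A] wt_so8[OF B] wt_so8[OF sp1_cubed_so8(1)] wt_so8[OF sp1_cubed_so8(2)]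
    wt_so8[OF triality_so8]
  wt_triality[OF A] wt_triality[OF B] wt_triality[OF sp1_cubed_so8(1)] wt_triality[OF
      sp1_cubed_so8(2)] wt_triality[OF triality_so8]
  wt_triality[OF so8_skew_products(1)] wt_triality[OF so8_skew_products(2)]

lemmas e8_bracket_unfold = e8_bracket.simps pair_bracket_def pair_act_def pair_triality_def curlywedge_def
  commutator_def fst_conv snd_conv fst_diff snd_diff fst_scaleR snd_scaleR

lemma bracket_so8: "e7_comp 0 (e8_bracket ((A, A'), u, v, w) ((B, B'), x, y, z)) \<in> so8"
  unfolding e8_bracket.simps e7_comp_simps pair_bracket_def pair_triality_def curlywedge_def fst_conv snd_conv
    fst_diff snd_diff fst_scaleR
  using A B by (intro so8_closed triality_so8 so8_skew_products so8_commutator)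

lemma bracket_sp1: "e7_comp 1 (e8_bracket ((A, A'), u, v, w) ((B, B'), x, y, z)) \<in> sp1_cubed"
proof -
  have "e7_comp 1 (e8_bracket ((A, A'), u, v, w) ((B, B'), x, y, z)) \<in> so8"
    unfolding e8_bracket.simps e7_comp_simps pair_bracket_def pair_triality_def curlywedge_def fst_conv snd_conv
      fst_diff snd_diff snd_scaleR
    using sp1_cubed_so8 by (intro so8_closed triality_so8 so8_skew_products so8_commutator)
  then show ?thesis
    unfolding sp1_cubed_iff e8_bracket_unfold e7_comp_simps
    by (simp add: wt_mult wt_transpose sum_8 so8_rules tensor_zero field_simps)
qed

lemma bracket_tensor:
  "e7_comp 2 (e8_bracket ((A, A'), u, v, w) ((B, B'), x, y, z)) \<in> oct_tensor_quat"
  "e7_comp 3 (e8_bracket ((A, A'), u, v, w) ((B, B'), x, y, z)) \<in> oct_tensor_quat"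
  "e7_comp 4 (e8_bracket ((A, A'), u, v, w) ((B, B'), x, y, z)) \<in> oct_tensor_quat"
  unfolding oct_tensor_quat_iff e8_bracket_unfold e7_comp_simps
  by (simp_all add: wt_bracket so8_rules tensor_zero)

text \<open>This lemma and the next six give the Cartan part of the bracket, the negative of the sum
  of $x_a y_{-a} a$ over all roots a. The coefficient is the linear form of the same diagonal
  coordinate in \<open>e7_cartan_diag\<close>, evaluated at the root.\<close>

lemma bracket_diag_0:
  "wt (e7_comp 0 (e8_bracket ((A, A'), u, v, w) ((B, B'), x, y, z))) 0 1 =
    - (\<Sum>l\<leftarrow>e7_roots. e7_coord ((A, A'), u, v, w) (lattice_vec l) * e7_coord ((B, B'), x, y, z) (- lattice_vec l)
        * of_int (- lattice_vec l $ 1 + 2 * lattice_vec l $ 3 - 2 * lattice_vec l $ 4 + lattice_vec l $ 5 - lattice_vec l $ 6))"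
  by (simp only: e7_roots_eq list.map sum_list_Cons lattice_vec_uminus lattice_vec_nth,
      simp only: int_evaluation of_int_0 of_int_1 of_int_minus of_int_numeral,
      simp only: e7_coord_eq e8_bracket_unfold e7_comp_simps,
      simp only: wt_linear wt_bracket so8_rules tensor_zero,
      simp,
      simp add: algebra_simps,
      (simp add: field_simps)?)

lemma bracket_diag_1:
  "wt (e7_comp 0 (e8_bracket ((A, A'), u, v, w) ((B, B'), x, y, z))) 2 3 =
    - (\<Sum>l\<leftarrow>e7_roots. e7_coord ((A, A'), u, v, w) (lattice_vec l) * e7_coord ((B, B'), x, y, z) (- lattice_vec l)
        * of_int (lattice_vec l $ 1 + 2 * lattice_vec l $ 2 - 2 * lattice_vec l $ 3 + lattice_vec l $ 5 - lattice_vec l $ 6))"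
  by (simp only: e7_roots_eq list.map sum_list_Cons lattice_vec_uminus lattice_vec_nth,
      simp only: int_evaluation of_int_0 of_int_1 of_int_minus of_int_numeral,
      simp only: e7_coord_eq e8_bracket_unfold e7_comp_simps,
      simp only: wt_linear wt_bracket so8_rules tensor_zero,
      simp,
      simp add: algebra_simps,
      (simp add: field_simps)?)

lemma bracket_diag_2:
  "wt (e7_comp 0 (e8_bracket ((A, A'), u, v, w) ((B, B'), x, y, z))) 4 5 =
    - (\<Sum>l\<leftarrow>e7_roots. e7_coord ((A, A'), u, v, w) (lattice_vec l) * e7_coord ((B, B'), x, y, z) (- lattice_vec l)
        * of_int (- 2 * lattice_vec l $ 0 + lattice_vec l $ 1 + lattice_vec l $ 5 - lattice_vec l $ 6))"
  by (simp only: e7_roots_eq list.map sum_list_Cons lattice_vec_uminus lattice_vec_nth,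
      simp only: int_evaluation of_int_0 of_int_1 of_int_minus of_int_numeral,
      simp only: e7_coord_eq e8_bracket_unfold e7_comp_simps,
      simp only: wt_linear wt_bracket so8_rules tensor_zero,
      simp,
      simp add: algebra_simps,
      (simp add: field_simps)?)

lemma bracket_diag_3:
  "wt (e7_comp 0 (e8_bracket ((A, A'), u, v, w) ((B, B'), x, y, z))) 6 7 =
    - (\<Sum>l\<leftarrow>e7_roots. e7_coord ((A, A'), u, v, w) (lattice_vec l) * e7_coord ((B, B'), x, y, z) (- lattice_vec l)
        * of_int (- 2 * lattice_vec l $ 0 - lattice_vec l $ 1 + 2 * lattice_vec l $ 2 - lattice_vec l $ 5 + lattice_vec l $ 6))"
  by (simp only: e7_roots_eq list.map sum_list_Cons lattice_vec_uminus lattice_vec_nth,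
      simp only: int_evaluation of_int_0 of_int_1 of_int_minus of_int_numeral,
      simp only: e7_coord_eq e8_bracket_unfold e7_comp_simps,
      simp only: wt_linear wt_bracket so8_rules tensor_zero,
      simp,
      simp add: algebra_simps,
      (simp add: field_simps)?)

lemma bracket_diag_4:
  "wt (e7_comp 1 (e8_bracket ((A, A'), u, v, w) ((B, B'), x, y, z))) 0 1 =
    - (\<Sum>l\<leftarrow>e7_roots. e7_coord ((A, A'), u, v, w) (lattice_vec l) * e7_coord ((B, B'), x, y, z) (- lattice_vec l)
        * of_int (- lattice_vec l $ 1 + 2 * lattice_vec l $ 4 - lattice_vec l $ 5 - lattice_vec l $ 6))"
  by (simp only: e7_roots_eq list.map sum_list_Cons lattice_vec_uminus lattice_vec_nth,
      simp only: int_evaluation of_int_0 of_int_1 of_int_minus of_int_numeral,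
      simp only: e7_coord_eq e8_bracket_unfold e7_comp_simps,
      simp only: wt_linear wt_bracket so8_rules tensor_zero,
      simp,
      simp add: algebra_simps,
      (simp add: field_simps)?)

lemma bracket_diag_5:
  "wt (e7_comp 1 (e8_bracket ((A, A'), u, v, w) ((B, B'), x, y, z))) 2 3 =
    - (\<Sum>l\<leftarrow>e7_roots. e7_coord ((A, A'), u, v, w) (lattice_vec l) * e7_coord ((B, B'), x, y, z) (- lattice_vec l)
        * of_int (lattice_vec l $ 1 - lattice_vec l $ 5 - lattice_vec l $ 6))"
  by (simp only: e7_roots_eq list.map sum_list_Cons lattice_vec_uminus lattice_vec_nth,
      simp only: int_evaluation of_int_0 of_int_1 of_int_minus of_int_numeral,
      simp only: e7_coord_eq e8_bracket_unfold e7_comp_simps,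
      simp only: wt_linear wt_bracket so8_rules tensor_zero,
      simp,
      simp add: algebra_simps,
      (simp add: field_simps)?)

lemma bracket_diag_6:
  "wt (e7_comp 1 (e8_bracket ((A, A'), u, v, w) ((B, B'), x, y, z))) 4 5 =
    - (\<Sum>l\<leftarrow>e7_roots. e7_coord ((A, A'), u, v, w) (lattice_vec l) * e7_coord ((B, B'), x, y, z) (- lattice_vec l)
        * of_int (- lattice_vec l $ 1 + lattice_vec l $ 5 - lattice_vec l $ 6))"
  by (simp only: e7_roots_eq list.map sum_list_Cons lattice_vec_uminus lattice_vec_nth,
      simp only: int_evaluation of_int_0 of_int_1 of_int_minus of_int_numeral,
      simp only: e7_coord_eq e8_bracket_unfold e7_comp_simps,
      simp only: wt_linear wt_bracket so8_rules tensor_zero,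
      simp,
      simp add: algebra_simps,
      (simp add: field_simps)?)

text \<open>With the next four lemmas this is the verification root by root. For each root, 32 roots
  have inner product 1 with it and enter the sum of products.\<close>

lemma bracket_coord_so8_table:
  "list_all (bracket_coord_at ((A, A'), u, v, w) ((B, B'), x, y, z)) (map fst e7_so8_table)"
  unfolding e7_so8_table_def list.map fst_conv list_all_eval simp_thms
  \<comment> \<open>The stages are: select the partners by integer arithmetic; evaluate differences,
    signs and root values; pass to weight coordinates; expand the bracket and reduce to independent
    coordinates; compare. The last stage unfolds \<open>e7_comp_def\<close> because
    \<open>simp\<close> has turned the component number 1 into \<open>Suc 0\<close>, which
    \<open>e7_comp_simps\<close> does not match.\<close>
  by (intro conjI;
      simp only: bracket_coord_at_def cartan_row.simps e7_roots_eq filter_conds dot7.simps int_evaluation,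
      simp only: list.map sum_list_Cons lattice_vec_diff root_sign_E7 lattice_vec_nth root_value_E7
        e7_cartan_nth,
      simp,
      simp only: e7_coord_eq e8_bracket_unfold e7_comp_simps,
      simp only: wt_linear wt_bracket so8_rules tensor_zero,
      simp,
      simp add: field_simps e7_comp_def)

lemma bracket_coord_sp1_table:
  "list_all (bracket_coord_at ((A, A'), u, v, w) ((B, B'), x, y, z)) (map fst e7_sp1_table)"
  unfolding e7_sp1_table_def list.map fst_conv list_all_eval simp_thms
  by (intro conjI;
      simp only: bracket_coord_at_def cartan_row.simps e7_roots_eq filter_conds dot7.simps int_evaluation,
      simp only: list.map sum_list_Cons lattice_vec_diff root_sign_E7 lattice_vec_nth root_value_E7
        e7_cartan_nth,
      simp,
      simp only: e7_coord_eq e8_bracket_unfold e7_comp_simps,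
      simp only: wt_linear wt_bracket so8_rules tensor_zero,
      simp,
      simp add: field_simps e7_comp_def)

lemma bracket_coord_table_1:
  "list_all (bracket_coord_at ((A, A'), u, v, w) ((B, B'), x, y, z)) (map fst e7_table_1)"
  unfolding e7_table_1_def list.map fst_conv list_all_eval simp_thms
  by (intro conjI;
      simp only: bracket_coord_at_def cartan_row.simps e7_roots_eq filter_conds dot7.simps int_evaluation,
      simp only: list.map sum_list_Cons lattice_vec_diff root_sign_E7 lattice_vec_nth root_value_E7
        e7_cartan_nth,
      simp,
      simp only: e7_coord_eq e8_bracket_unfold e7_comp_simps,
      simp only: wt_linear wt_bracket so8_rules tensor_zero,
      simp,
      simp add: field_simps e7_comp_def)

lemma bracket_coord_table_2:
  "list_all (bracket_coord_at ((A, A'), u, v, w) ((B, B'), x, y, z)) (map fst e7_table_2)"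
  unfolding e7_table_2_def list.map fst_conv list_all_eval simp_thms
  by (intro conjI;
      simp only: bracket_coord_at_def cartan_row.simps e7_roots_eq filter_conds dot7.simps int_evaluation,
      simp only: list.map sum_list_Cons lattice_vec_diff root_sign_E7 lattice_vec_nth root_value_E7
        e7_cartan_nth,
      simp,
      simp only: e7_coord_eq e8_bracket_unfold e7_comp_simps,
      simp only: wt_linear wt_bracket so8_rules tensor_zero,
      simp,
      simp add: field_simps e7_comp_def)

lemma bracket_coord_table_3:
  "list_all (bracket_coord_at ((A, A'), u, v, w) ((B, B'), x, y, z)) (map fst e7_table_3)"
  unfolding e7_table_3_def list.map fst_conv list_all_eval simp_thms
  by (intro conjI;
      simp only: bracket_coord_at_def cartan_row.simps e7_roots_eq filter_conds dot7.simps int_evaluation,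
      simp only: list.map sum_list_Cons lattice_vec_diff root_sign_E7 lattice_vec_nth root_value_E7
        e7_cartan_nth,
      simp,
      simp only: e7_coord_eq e8_bracket_unfold e7_comp_simps,
      simp only: wt_linear wt_bracket so8_rules tensor_zero,
      simp,
      simp add: field_simps e7_comp_def)

end

section \<open>The isomorphism\<close>

text \<open>A Cartan element acts on the index p by half its coordinate at (p,
  \<open>bar p\<close>). The right-hand sides are thus twice the weights of the indices, evaluated
  at the vector with simple root coordinates \<open>e7_cartan X\<close>.\<close>

lemma e7_cartan_diag:
  "wt (e7_comp 0 X) 0 1 = - e7_cartan X $ 1 + 2 * e7_cartan X $ 3 - 2 * e7_cartan X $ 4 +
      e7_cartan X $ 5 - e7_cartan X $ 6"
  "wt (e7_comp 0 X) 2 3 = e7_cartan X $ 1 + 2 * e7_cartan X $ 2 - 2 * e7_cartan X $ 3 + e7_cartan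
      X $ 5 - e7_cartan X $ 6"
  "wt (e7_comp 0 X) 4 5 = - 2 * e7_cartan X $ 0 + e7_cartan X $ 1 + e7_cartan X $ 5 - e7_cartan X $ 6"
  "wt (e7_comp 0 X) 6 7 = - 2 * e7_cartan X $ 0 - e7_cartan X $ 1 + 2 * e7_cartan X $ 2 -
      e7_cartan X $ 5 + e7_cartan X $ 6"
  "wt (e7_comp 1 X) 0 1 = - e7_cartan X $ 1 + 2 * e7_cartan X $ 4 - e7_cartan X $ 5 - e7_cartan X $ 6"
  "wt (e7_comp 1 X) 2 3 = e7_cartan X $ 1 - e7_cartan X $ 5 - e7_cartan X $ 6"
  "wt (e7_comp 1 X) 4 5 = - e7_cartan X $ 1 + e7_cartan X $ 5 - e7_cartan X $ 6"
  unfolding e7_cartan_nth by (simp_all add: field_simps)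

lemma e7_cartan_eqI:
  assumes
    "wt (e7_comp 0 X) 0 1 = - h $ 1 + 2 * h $ 3 - 2 * h $ 4 + h $ 5 - h $ 6"
    "wt (e7_comp 0 X) 2 3 = h $ 1 + 2 * h $ 2 - 2 * h $ 3 + h $ 5 - h $ 6"
    "wt (e7_comp 0 X) 4 5 = - 2 * h $ 0 + h $ 1 + h $ 5 - h $ 6"
    "wt (e7_comp 0 X) 6 7 = - 2 * h $ 0 - h $ 1 + 2 * h $ 2 - h $ 5 + h $ 6"
    "wt (e7_comp 1 X) 0 1 = - h $ 1 + 2 * h $ 4 - h $ 5 - h $ 6"
    "wt (e7_comp 1 X) 2 3 = h $ 1 - h $ 5 - h $ 6"
    "wt (e7_comp 1 X) 4 5 = - h $ 1 + h $ 5 - h $ 6"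
  shows "e7_cartan X = h"
  unfolding vec_eq_iff forall_7 e7_cartan_nth assms by (simp add: field_simps)

lemma e7_subspace_iff:
  "X \<in> e7_subspace \<longleftrightarrow> e7_comp 0 X \<in> so8 \<and> e7_comp 1 X \<in> sp1_cubed \<and>
     e7_comp 2 X \<in> oct_tensor_quat \<and> e7_comp 3 X \<in> oct_tensor_quat \<and> e7_comp 4 X \<in> oct_tensor_quat"
  unfolding e7_comp_simps e7_subspace_def mem_Times_iff by blast

lemma e7_subspaceE:
  assumes "X \<in> e7_subspace"
  obtains A A' u v w where "X = ((A, A'), u, v, w)" "A \<in> so8" "A' \<in> sp1_cubed"
    "u \<in> oct_tensor_quat" "v \<in> oct_tensor_quat" "w \<in> oct_tensor_quat"
  using assms unfolding e7_subspace_def by blast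

lemma e7_bracket_closed:
  assumes "X \<in> e7_subspace" "Y \<in> e7_subspace"
  shows "e8_bracket X Y \<in> e7_subspace"
proof -
  obtain A A' u v w where X: "X = ((A, A'), u, v, w)" "A \<in> so8" "A' \<in> sp1_cubed"
    "u \<in> oct_tensor_quat" "v \<in> oct_tensor_quat" "w \<in> oct_tensor_quat"
    using assms(1) by (rule e7_subspaceE)
  obtain B B' x y z where Y: "Y = ((B, B'), x, y, z)" "B \<in> so8" "B' \<in> sp1_cubed"
    "x \<in> oct_tensor_quat" "y \<in> oct_tensor_quat" "z \<in> oct_tensor_quat"
    using assms(2) by (rule e7_subspaceE)
  show ?thesis
    unfolding e7_subspace_iff X(1) Y(1) using X(2-) Y(2-)
    by (intro conjI bracket_so8 bracket_sp1 bracket_tensor)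
qed

lemma bracket_coord:
  assumes "X \<in> e7_subspace" "Y \<in> e7_subspace" "c \<in> roots cartan_E7"
  shows "e7_coord (e8_bracket X Y) c =
    root_value cartan_E7 c (e7_cartan X) * e7_coord Y c - root_value cartan_E7 c (e7_cartan Y) * e7_coord X c
    + (\<Sum>a | a \<in> roots cartan_E7 \<and> c - a \<in> roots cartan_E7.
         root_sign cartan_E7 a (c - a) * e7_coord X a * e7_coord Y (c - a))"
proof -
  obtain A A' u v w where X: "X = ((A, A'), u, v, w)" "A \<in> so8" "A' \<in> sp1_cubed"
    "u \<in> oct_tensor_quat" "v \<in> oct_tensor_quat" "w \<in> oct_tensor_quat"
    using assms(1) by (rule e7_subspaceE)
  obtain B B' x y z where Y: "Y = ((B, B'), x, y, z)" "B \<in> so8" "B' \<in> sp1_cubed"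
    "x \<in> oct_tensor_quat" "y \<in> oct_tensor_quat" "z \<in> oct_tensor_quat"
    using assms(2) by (rule e7_subspaceE)
  obtain l where c: "c = lattice_vec l" and l: "l \<in> set e7_roots"
    using assms(3) unfolding roots_E7 by blast
  note blocks = bracket_coord_so8_table bracket_coord_sp1_table bracket_coord_table_1
    bracket_coord_table_2 bracket_coord_table_3
  note blocks' = blocks[OF X(2) Y(2) X(3) Y(3) X(4-6) Y(4-6), folded X(1) Y(1),
    unfolded list_all_iff bracket_coord_at_def, rule_format]
  have "l \<in> set (map fst e7_so8_table) \<or> l \<in> set (map fst e7_sp1_table) \<or> l \<in> set (map fst e7_table_1)
      \<or> l \<in> set (map fst e7_table_2) \<or> l \<in> set (map fst e7_table_3)"
    using l unfolding e7_roots_def e7_table_def map_append set_append by blast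
  then have "e7_coord (e8_bracket X Y) c =
      root_value cartan_E7 c (e7_cartan X) * e7_coord Y c - root_value cartan_E7 c (e7_cartan Y) * e7_coord X c
      + (\<Sum>k\<leftarrow>filter (\<lambda>k. dot7 (cartan_row l) k = 1) e7_roots.
          root_sign cartan_E7 (lattice_vec k) (c - lattice_vec k)
          * e7_coord X (lattice_vec k) * e7_coord Y (c - lattice_vec k))"
    unfolding c by (elim disjE) (erule blocks')+
  moreover have "filter (\<lambda>k. dot7 (cartan_row l) k = 1) e7_roots
      = filter (\<lambda>k. lattice_form cartan_E7 c (lattice_vec k) = 1) e7_roots"
    using length_e7_roots l unfolding c by (intro filter_cong refl) (simp add: lattice_form_dot7)
  ultimately show ?thesis
    by (simp add: sum_root_decompositions[OF assms(3)])
qed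

lemma bracket_cartan:
  assumes "X \<in> e7_subspace" "Y \<in> e7_subspace"
  shows "e7_cartan (e8_bracket X Y) =
    (\<chi> i. - (\<Sum>a\<in>roots cartan_E7. e7_coord X a * e7_coord Y (- a) * of_int (a $ i)))"
proof -
  obtain A A' u v w where X: "X = ((A, A'), u, v, w)" "A \<in> so8" "A' \<in> sp1_cubed"
    "u \<in> oct_tensor_quat" "v \<in> oct_tensor_quat" "w \<in> oct_tensor_quat"
    using assms(1) by (rule e7_subspaceE)
  obtain B B' x y z where Y: "Y = ((B, B'), x, y, z)" "B \<in> so8" "B' \<in> sp1_cubed"
    "x \<in> oct_tensor_quat" "y \<in> oct_tensor_quat" "z \<in> oct_tensor_quat"
    using assms(2) by (rule e7_subspaceE)
  note diags = bracket_diag_0 bracket_diag_1 bracket_diag_2 bracket_diag_3 bracket_diag_4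
    bracket_diag_5 bracket_diag_6
  note diags' = diags[OF X(2) Y(2) X(3) Y(3) X(4-6) Y(4-6), folded X(1) Y(1)]
  define f where "f l = e7_coord X (lattice_vec l) * e7_coord Y (- lattice_vec l)" for l
  \<comment> \<open>The list is kept arbitrary so that the seven linear forms can be pulled out of
    the sum by induction, without expanding 126 terms.\<close>
  define T where "T L i = (\<Sum>l\<leftarrow>L. f l * of_int (lattice_vec l $ i))" for L i
  have T: "T [] i = 0" "T (l # L) i = f l * of_int (lattice_vec l $ i) + T L i" for i l L
    by (simp_all add: T_def)
  have sums:
    "(\<Sum>l\<leftarrow>L. f l * of_int (- lattice_vec l $ 1 + 2 * lattice_vec l $ 3 - 2 * lattice_vec l $ 4 + lattice_vec l $ 5 - lattice_vec l $ 6)) = - T L 1 + 2 * T L 3 - 2 * T L 4 + T L 5 - T L 6"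
    "(\<Sum>l\<leftarrow>L. f l * of_int (lattice_vec l $ 1 + 2 * lattice_vec l $ 2 - 2 * lattice_vec l $ 3 + lattice_vec l $ 5 - lattice_vec l $ 6)) = T L 1 + 2 * T L 2 - 2 * T L 3 + T L 5 - T L 6"
    "(\<Sum>l\<leftarrow>L. f l * of_int (- 2 * lattice_vec l $ 0 + lattice_vec l $ 1 + lattice_vec l $ 5 - lattice_vec l $ 6)) = - 2 * T L 0 + T L 1 + T L 5 - T L 6"
    "(\<Sum>l\<leftarrow>L. f l * of_int (- 2 * lattice_vec l $ 0 - lattice_vec l $ 1 + 2 * lattice_vec l $ 2 - lattice_vec l $ 5 + lattice_vec l $ 6)) = - 2 * T L 0 - T L 1 + 2 * T L 2 - T L 5 + T L 6"
    "(\<Sum>l\<leftarrow>L. f l * of_int (- lattice_vec l $ 1 + 2 * lattice_vec l $ 4 - lattice_vec l $ 5 - lattice_vec l $ 6)) = - T L 1 + 2 * T L 4 - T L 5 - T L 6"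
    "(\<Sum>l\<leftarrow>L. f l * of_int (lattice_vec l $ 1 - lattice_vec l $ 5 - lattice_vec l $ 6)) = T L 1 - T L 5 - T L 6"
    "(\<Sum>l\<leftarrow>L. f l * of_int (- lattice_vec l $ 1 + lattice_vec l $ 5 - lattice_vec l $ 6)) = - T L 1 + T L 5 - T L 6"
    for L
    by (induction L) (simp_all add: T algebra_simps)
  have h: "(\<chi> i. - (\<Sum>a\<in>roots cartan_E7. e7_coord X a * e7_coord Y (- a) * of_int (a $ i)))
      = (\<chi> i. - T e7_roots i)"
    unfolding sum_roots T_def f_def ..
  show ?thesis
    unfolding h
    by (rule e7_cartan_eqI; unfold vec_lambda_beta diags' f_def[symmetric] sums) (simp_all add: algebra_simps)
qed

definition e7_iso :: "e8 \<Rightarrow> 7 chevalley" where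
  "e7_iso X = (e7_cartan X, e7_coord X)"

lemma e7_comp_linear: "e7_comp c (X + Y) = e7_comp c X + e7_comp c Y" "e7_comp c (r *\<^sub>R X) = r *\<^sub>R e7_comp c X"
  by (simp_all add: e7_comp_def)

lemma linear_e7_iso: "linear e7_iso"
proof (rule linearI)
  fix X Y :: e8 and r :: real
  have "e7_coord (X + Y) a = e7_coord X a + e7_coord Y a" for a
    unfolding e7_coord_def sum_list_addf[symmetric]
    by (intro arg_cong[where f = sum_list] map_cong refl) (auto simp: e7_comp_linear algebra_simps)
  moreover have "e7_cartan (X + Y) = e7_cartan X + e7_cartan Y"
    unfolding vec_eq_iff forall_7 vector_add_component e7_cartan_nth e7_comp_linear wt_linear
    by (simp add: field_simps)
  ultimately show "e7_iso (X + Y) = e7_iso X + e7_iso Y"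
    by (simp add: e7_iso_def fun_eq_iff)
  have "e7_coord (r *\<^sub>R X) a = r *\<^sub>R e7_coord X a" for a
    unfolding e7_coord_def scaleR_conv_of_real sum_list_const_mult[symmetric]
    by (intro arg_cong[where f = sum_list] map_cong refl) (auto simp: e7_comp_linear)
  moreover have "e7_cartan (r *\<^sub>R X) = r *\<^sub>R e7_cartan X"
    unfolding vec_eq_iff forall_7 vector_scaleR_component e7_cartan_nth e7_comp_linear wt_linear
      scaleR_conv_of_real[where 'a = complex]
    by (simp add: field_simps)
  ultimately show "e7_iso (r *\<^sub>R X) = r *\<^sub>R e7_iso X"
    by (simp add: e7_iso_def fun_eq_iff scaleR_fun_def)
qed

lemma e7_coord_nonroot:
  assumes "a \<notin> roots cartan_E7"
  shows "e7_coord X a = 0"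
proof -
  have "lattice_vec (fst t) \<noteq> a" if "t \<in> set e7_table" for t
    using assms that unfolding roots_E7 e7_roots_def by auto
  then have "e7_coord X a = (\<Sum>t\<leftarrow>e7_table. 0)"
    unfolding e7_coord_def by (intro arg_cong[where f = sum_list] map_cong refl) auto
  then show ?thesis by simp
qed

lemma e7_iso_bracket:
  assumes "X \<in> e7_subspace" "Y \<in> e7_subspace"
  shows "e7_iso (e8_bracket X Y) = compact_E7_bracket (e7_iso X) (e7_iso Y)"
  using assms
  by (auto simp: e7_iso_def compact_E7_bracket_def bracket_cartan bracket_coord e7_coord_nonroot)

lemma uminus_roots: "- a \<in> roots A \<longleftrightarrow> a \<in> roots A"
  by (simp add: roots_def lattice_form_def)

lemma cnj_wt: "cnj (wt X p q) = wt X (bar p) (bar q)"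
  by (simp add: wt_bar)

text \<open>The table assigns to opposite roots the positions (p, q) and (\<open>bar p\<close>,
  \<open>bar q\<close>) with equal real scales, so that the reality of the matrices gives the
  claim.\<close>

lemma e7_coord_uminus:
  assumes "X \<in> e7_subspace"
  shows "e7_coord X (- a) = cnj (e7_coord X a)"
proof (cases "a \<in> roots cartan_E7")
  case True
  have so8: "fst (fst X) \<in> so8" "snd (fst X) \<in> so8"
    using assms by (auto simp: e7_subspace_def sp1_cubed_iff)
  have "list_all (\<lambda>l. e7_coord X (- lattice_vec l) = cnj (e7_coord X (lattice_vec l))) e7_roots"
    unfolding e7_roots_eq list_all_eval simp_thms lattice_vec_uminus
    by (intro conjI; simp add: e7_coord_eq cnj_wt wt_so8[OF so8(1)] wt_so8[OF so8(2)])
  then show ?thesis using True unfolding roots_E7 list_all_iff by blast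
next
  case False
  then show ?thesis by (simp add: e7_coord_nonroot uminus_roots)
qed

lemma e7_iso_compact: "X \<in> e7_subspace \<Longrightarrow> e7_iso X \<in> compact_E7"
proof -
  assume X: "X \<in> e7_subspace"
  have so8: "e7_comp 0 X \<in> so8" "e7_comp 1 X \<in> so8"
    using X by (auto simp: e7_subspace_iff sp1_cubed_iff)
  have "\<forall>i. e7_cartan X $ i = - cnj (e7_cartan X $ i)"
    unfolding forall_7 e7_cartan_nth
    \<comment> \<open>Conjugation sends the coordinate at (p, \<open>bar p\<close>) to the one at
      (\<open>bar p\<close>, p), which is its negative by skewness; hence the Cartan part is
      imaginary. Rules about component 1 are put in the form \<open>Suc 0\<close> that
      \<open>simp\<close> produces.\<close>
    by (simp add: cnj_wt wt_so8[OF so8(1)] wt_so8[OF so8(2), unfolded One_nat_def] field_simps)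
  then show ?thesis
    using e7_coord_uminus[OF X] e7_coord_nonroot
    by (simp add: compact_E7_def compact_form_def e7_iso_def)
qed

section \<open>Bijectivity onto the compact form\<close>

lemma e7_table_nonzero: "list_all (\<lambda>(l, c, p, q, s). s \<noteq> 0) e7_table"
  unfolding e7_table_eq list_all_eval prod.case by simp

text \<open>Root coordinates determine the weight coordinates at the table positions, the Cartan
  part those at (p, \<open>bar p\<close>); skewness and the vanishing conditions of
  \<open>e7_subspace\<close> determine all others.\<close>

lemma inj_on_e7_iso: "inj_on e7_iso e7_subspace"
proof (rule inj_onI)
  fix X Y assume X: "X \<in> e7_subspace" and Y: "Y \<in> e7_subspace" and eq: "e7_iso X = e7_iso Y"
  have "list_all (\<lambda>(l, c, p, q, s). wt (e7_comp c X) p q = wt (e7_comp c Y) p q) e7_table"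
    unfolding list_all_iff
  proof (rule ballI, clarify)
    fix l c p q s assume t: "(l, c, p, q, s) \<in> set e7_table"
    have "e7_coord X (lattice_vec l) = e7_coord Y (lattice_vec l)" using eq by (simp add: e7_iso_def)
    moreover have "s \<noteq> 0" using e7_table_nonzero t by (auto simp: list_all_iff)
    ultimately show "wt (e7_comp c X) p q = wt (e7_comp c Y) p q"
      using e7_coord_table[of X] e7_coord_table[of Y] t by (fastforce simp: list_all_iff)
  qed
  note tab = this[unfolded e7_table_eq list_all_eval prod.case]
  have cart: "e7_cartan X = e7_cartan Y" using eq by (simp add: e7_iso_def)
  note diag = e7_cartan_diag[of X, unfolded cart, folded e7_cartan_diag[of Y]]
  have c: "e7_comp 0 X \<in> so8" "e7_comp 0 Y \<in> so8" "e7_comp 1 X \<in> so8" "e7_comp 1 Y \<in> so8"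
    and sp: "e7_comp 1 X \<in> sp1_cubed" "e7_comp 1 Y \<in> sp1_cubed"
    and ot: "e7_comp 2 X \<in> oct_tensor_quat" "e7_comp 3 X \<in> oct_tensor_quat" "e7_comp 4 X \<in> oct_tensor_quat"
      "e7_comp 2 Y \<in> oct_tensor_quat" "e7_comp 3 Y \<in> oct_tensor_quat" "e7_comp 4 Y \<in> oct_tensor_quat"
    using X Y by (auto simp: e7_subspace_iff sp1_cubed_iff)
  have "\<forall>p q. wt (e7_comp 0 X) p q = wt (e7_comp 0 Y) p q"
    unfolding forall_8 by (simp add: tab diag wt_so8[OF c(1)] wt_so8[OF c(2)])
  then have 0: "e7_comp 0 X = e7_comp 0 Y" by (intro wt_eqI) blast
  have "\<forall>p q. wt (e7_comp 1 X) p q = wt (e7_comp 1 Y) p q"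
    unfolding forall_8
    by (simp add: tab[unfolded One_nat_def] diag[unfolded One_nat_def] wt_so8[OF c(3), unfolded One_nat_def]
        wt_so8[OF c(4), unfolded One_nat_def] wt_sp1_zero[OF sp(1), unfolded One_nat_def]
        wt_sp1_zero[OF sp(2), unfolded One_nat_def])
  then have 1: "e7_comp 1 X = e7_comp 1 Y" by (intro wt_eqI) blast
  have "\<forall>p q. wt (e7_comp 2 X) p q = wt (e7_comp 2 Y) p q"
    "\<forall>p q. wt (e7_comp 3 X) p q = wt (e7_comp 3 Y) p q"
    "\<forall>p q. wt (e7_comp 4 X) p q = wt (e7_comp 4 Y) p q"
    unfolding forall_8 using ot by (simp_all add: tab oct_tensor_quat_iff)
  then have "e7_comp 2 X = e7_comp 2 Y" "e7_comp 3 X = e7_comp 3 Y" "e7_comp 4 X = e7_comp 4 Y"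
    by (auto intro!: wt_eqI)
  then show "X = Y"
    using 0 1 unfolding e7_comp_simps by (simp add: prod_eq_iff)
qed

text \<open>The table read in the opposite direction, from root coordinates to matrix positions. It
  inverts \<open>e7_coord\<close> because no position occurs twice.\<close>

definition e7_entry :: "(int ^ 7 \<Rightarrow> complex) \<Rightarrow> nat \<Rightarrow> 8
    \<Rightarrow> 8 \<Rightarrow> complex" where
  "e7_entry x c p q = (\<Sum>(l, c', p', q', s)\<leftarrow>e7_table.
     if (c', p', q') = (c, p, q) then x (lattice_vec l) / of_real s else 0)"

lemma distinct_e7_positions: "distinct (map (\<lambda>(l, c, p, q, s). (c, p, q)) e7_table)"
  unfolding e7_table_eq by (simp add: neq_8)

lemma e7_entry_table:
  "list_all (\<lambda>(l, c, p, q, s). e7_entry x c p q = x (lattice_vec l) / of_real s) e7_table"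
  unfolding list_all_iff
proof
  fix t assume t: "t \<in> set e7_table"
  obtain l c p q s where [simp]: "t = (l, c, p, q, s)" by (cases t)
  let ?pos = "\<lambda>(l, c, p, q, s). (c, p, q)"
  have "e7_entry x c p q = (\<Sum>t'\<leftarrow>e7_table. if ?pos t' = ?pos t then
      (case t' of (l, c, p, q, s) \<Rightarrow> x (lattice_vec l) / of_real s) else 0)"
    unfolding e7_entry_def
  proof (intro arg_cong[where f = sum_list] map_cong refl)
    fix t'
    show "(case t' of (l, c', p', q', s) \<Rightarrow>
          if (c', p', q') = (c, p, q) then x (lattice_vec l) / of_real s else 0)
        = (if ?pos t' = ?pos t then (case t' of (l, c, p, q, s) \<Rightarrow> x (lattice_vec l) / of_real s) else 0)"
      by (cases t') simp
  qed
  also have "\<dots> = (case t of (l, c, p, q, s) \<Rightarrow> x (lattice_vec l) / of_real s)"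
    by (rule sum_list_single[OF distinct_e7_positions t])
  finally show "case t of (l, c, p, q, s) \<Rightarrow> e7_entry x c p q = x (lattice_vec l) / of_real s"
    by simp
qed

lemmas e7_entry_eq = e7_entry_table[unfolded e7_table_eq list_all_eval prod.case simp_thms]

lemma less_8:
  "p < (0::8) \<longleftrightarrow> False" "p < (1::8) \<longleftrightarrow> p \<in> {0}" "p < (2::8) \<longleftrightarrow> p \<in> {0, 1}"
  "p < (3::8) \<longleftrightarrow> p \<in> {0, 1, 2}" "p < (4::8) \<longleftrightarrow> p \<in> {0, 1, 2, 3}"
  "p < (5::8) \<longleftrightarrow> p \<in> {0, 1, 2, 3, 4}" "p < (6::8) \<longleftrightarrow> p \<in> {0, 1, 2, 3, 4, 5}"
  "p < (7::8) \<longleftrightarrow> p \<in> {0, 1, 2, 3, 4, 5, 6}"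
  by (simp_all only: lessThan_iff[symmetric] lessThan_8 empty_iff)

text \<open>A preimage is assembled in weight coordinates and turned into real matrices by
  \<open>unwt\<close>. The reality this requires comes from the two conjugation conditions of the
  compact form, the one on \<open>h\<close> for the diagonal coordinates and the one on
  \<open>x\<close> for the root coordinates.\<close>

lemma e7_iso_onto: "compact_E7 \<subseteq> e7_iso ` e7_subspace"
proof
  fix hx assume "hx \<in> compact_E7"
  then obtain h x where hx: "hx = (h, x)" and h: "\<forall>i. h $ i = - cnj (h $ i)"
    and x: "\<And>a. x (- a) = cnj (x a)" and x0: "\<And>a. a \<notin> roots cartan_E7 \<Longrightarrow> x a = 0"
    by (auto simp: compact_E7_def compact_form_def)
  have h': "cnj (h $ i) = - h $ i" for i
    using h by (metis complex_cnj_cnj complex_cnj_minus)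
  \<comment> \<open>The diagonal coordinates that \<open>e7_cartan_eqI\<close> demands of a
    preimage.\<close>
  define d0 where "d0 = - h $ 1 + 2 * h $ 3 - 2 * h $ 4 + h $ 5 - h $ 6"
  define d1 where "d1 = h $ 1 + 2 * h $ 2 - 2 * h $ 3 + h $ 5 - h $ 6"
  define d2 where "d2 = - 2 * h $ 0 + h $ 1 + h $ 5 - h $ 6"
  define d3 where "d3 = - 2 * h $ 0 - h $ 1 + 2 * h $ 2 - h $ 5 + h $ 6"
  define d4 where "d4 = - h $ 1 + 2 * h $ 4 - h $ 5 - h $ 6"
  define d5 where "d5 = h $ 1 - h $ 5 - h $ 6"
  define d6 where "d6 = - h $ 1 + h $ 5 - h $ 6"
  have d: "cnj d0 = - d0" "cnj d1 = - d1" "cnj d2 = - d2" "cnj d3 = - d3" "cnj d4 = - d4" "cnj d5 = - d5" "cnj d6 = - d6"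
    by (simp_all add: d0_def d1_def d2_def d3_def d4_def d5_def d6_def h')
  define D0 where "D0 p = (if p = 0 then d0 else if p = 1 then - d0 else if p = 2 then d1 else if p = 3 then - d1
    else if p = 4 then d2 else if p = 5 then - d2 else if p = 6 then d3 else - d3)" for p :: 8
  define D1 where "D1 p = (if p = 0 then d4 else if p = 1 then - d4 else if p = 2 then d5 else if p = 3 then - d5
    else if p = 4 \<or> p = 7 then d6 else - d6)" for p :: 8
  \<comment> \<open>For the two skew components the table holds only positions with p < q; the
    transposed ones are filled in by skewness.\<close>
  define W0 where "W0 p q = (if q = bar p then D0 p else if p < q then e7_entry x 0 p q
    else if q < p then - e7_entry x 0 q p else 0)" for p q
  define W1 where "W1 p q = (if q = bar p then D1 p
    else if (p, q) \<in> {(0,2), (0,3), (1,2), (1,3), (4,7), (5,6)} then e7_entry x 1 p q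
    else if (q, p) \<in> {(0,2), (0,3), (1,2), (1,3), (4,7), (5,6)} then - e7_entry x 1 q p else 0)" for p q
  define W where "W c p q = (if q \<in> {0,1,2,3} then e7_entry x c p q else 0)" for c p q
  note cnj_x = x[symmetric] lattice_vec_uminus
  have "\<forall>p q. W0 (bar p) (bar q) = cnj (W0 p q)"
    unfolding forall_8 W0_def by (simp add: neq_8 less_8 D0_def d e7_entry_eq cnj_x)
  then have A: "wt (unwt W0) p q = W0 p q" for p q by (intro wt_unwt) blast
  have "\<forall>p q. W1 (bar p) (bar q) = cnj (W1 p q)"
    unfolding forall_8 W1_def by (simp add: neq_8 D1_def d e7_entry_eq[unfolded One_nat_def] cnj_x)
  then have A': "wt (unwt W1) p q = W1 p q" for p q by (intro wt_unwt) blast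
  have "\<forall>p q. W c (bar p) (bar q) = cnj (W c p q)" if "c \<in> {2, 3, 4}" for c
    unfolding forall_8 W_def using that by (elim insertE) (simp_all add: neq_8 e7_entry_eq cnj_x)
  then have V: "wt (unwt (W c)) p q = W c p q" if "c \<in> {2, 3, 4}" for c p q
    using that by (intro wt_unwt) blast
  define X where "X = ((unwt W0, unwt W1), unwt (W 2), unwt (W 3), unwt (W 4))"
  have comp: "e7_comp 0 X = unwt W0" "e7_comp 1 X = unwt W1" "e7_comp 2 X = unwt (W 2)"
    "e7_comp 3 X = unwt (W 3)" "e7_comp 4 X = unwt (W 4)"
    by (simp_all add: X_def e7_comp_def)
  have "\<forall>p q. W0 q p = - W0 p q"
    unfolding forall_8 W0_def by (simp add: neq_8 less_8 D0_def)
  then have s0: "unwt W0 \<in> so8" unfolding so8_iff_wt A .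
  have "\<forall>p q. W1 q p = - W1 p q"
    unfolding forall_8 W1_def by (simp add: neq_8 D1_def)
  then have "unwt W1 \<in> so8" unfolding so8_iff_wt A' .
  then have s1: "unwt W1 \<in> sp1_cubed"
    unfolding sp1_cubed_iff A' by (simp add: W1_def D1_def neq_8)
  have "unwt (W c) \<in> oct_tensor_quat" if "c \<in> {2, 3, 4}" for c
    unfolding oct_tensor_quat_iff V[OF that] by (simp add: W_def neq_8)
  then have "X \<in> e7_subspace"
    using s0 s1 by (simp add: e7_subspace_iff comp[unfolded One_nat_def])
  moreover have "e7_iso X = hx"
  proof -
    have "e7_cartan X = h"
      by (rule e7_cartan_eqI; unfold comp A A')
        (simp_all add: W0_def W1_def D0_def D1_def neq_8 d0_def d1_def d2_def d3_def d4_def d5_def d6_def)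
    moreover have "e7_coord X a = x a" for a
    proof (cases "a \<in> roots cartan_E7")
      case True
      have "list_all (\<lambda>l. e7_coord X (lattice_vec l) = x (lattice_vec l)) e7_roots"
        unfolding e7_roots_eq list_all_eval simp_thms
        by (intro conjI; simp only: e7_coord_eq e7_comp_simps[symmetric] comp A A' V insert_iff simp_thms)
          (simp_all add: W0_def W1_def W_def neq_8 less_8 e7_entry_eq[unfolded One_nat_def])
      then show ?thesis using True unfolding roots_E7 list_all_iff by blast
    qed (simp add: e7_coord_nonroot x0)
    ultimately show ?thesis by (simp add: e7_iso_def hx fun_eq_iff)
  qed
  ultimately show "hx \<in> e7_iso ` e7_subspace" by blast
qed

lemma subspace_e7: "subspace e7_subspace"
  unfolding subspace_def
proof (intro conjI ballI allI)
  show "0 \<in> e7_subspace"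
    by (simp add: e7_subspace_iff sp1_cubed_iff oct_tensor_quat_iff so8_closed e7_comp_def)
next
  fix X Y assume "X \<in> e7_subspace" "Y \<in> e7_subspace"
  then show "X + Y \<in> e7_subspace"
    by (simp add: e7_subspace_iff sp1_cubed_iff oct_tensor_quat_iff so8_closed e7_comp_linear)
next
  fix c :: real and X assume "X \<in> e7_subspace"
  then show "c *\<^sub>R X \<in> e7_subspace"
    by (simp add: e7_subspace_iff sp1_cubed_iff oct_tensor_quat_iff so8_closed e7_comp_linear)
qed

theorem lemma6p1:
  shows "lie_subalgebra e7_subspace e8_carrier e8_bracket \<and>
         lie_isomorphic e7_subspace e8_bracket compact_E7 compact_E7_bracket"
proof
  have "e7_subspace \<subseteq> e8_carrier"
    by (auto simp: e7_subspace_def e8_carrier_def sp1_cubed_iff)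
  then show "lie_subalgebra e7_subspace e8_carrier e8_bracket"
    unfolding lie_subalgebra_def using subspace_e7 e7_bracket_closed by blast
  have "bij_betw e7_iso e7_subspace compact_E7"
    unfolding bij_betw_def using inj_on_e7_iso e7_iso_compact e7_iso_onto by blast
  then show "lie_isomorphic e7_subspace e8_bracket compact_E7 compact_E7_bracket"
    unfolding lie_isomorphic_def using linear_e7_iso e7_iso_bracket by blast
qed

end
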